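(* Let $\lambda,\delta>0$. If $\Omega\subset\mathbb{R}^n$ is a convex bounded domain and $u(x,t)$ is a solution of $(F_{\lambda,\delta})$ quenching in finite time $T$, then there exists a constant $0<M<\infty$ such that $$M(T-t)^{1/3}\le 1-u(x,t)\qquad\text{for all }(x,t)\in\Omega\times[0,T).$$ Moreover, $u_t\to+\infty$ as $u$ quenches (i.e. as $u\to1$).
   Context: The parabolic problem $(F_{\lambda,\delta})$ is $$u_t-\Delta u=\lambda\frac{1+\delta|\nabla u|^2}{(1-u)^2}\ \text{ in }\Omega\times[0,T),\qquad u=0\ \text{ on }\partial\Omega\times[0,T),\qquad u(x,0)=0\ \text{ for }x\in\Omega.$$ The quenching time is $T=\sup\{t>0:\ \|u(\cdot,\tau)\|_\infty<1\ \ \forall\tau\in[0,t]\}$, and $u$ quenches in finite time if $T<\infty$. "$u_t\to+\infty$ as $u$ quenches" means: whenever $(x_k,t_k)\in\Omega\times[0,T)$ with $t_k\to T$ and $u(x_k,t_k)\to1$, one has $u_t(x_k,t_k)\to+\infty$. *)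

theory Defs
  imports "HOL-Analysis.Analysis"
begin

subsection \<open>Differential operators on \<open>R^n\<close>\<close>

definition pderiv_at :: "'n \<Rightarrow> (real ^ 'n \<Rightarrow> real) \<Rightarrow> real ^ 'n \<Rightarrow> real" where
  "pderiv_at i f x = deriv (\<lambda>s. f (x + s *\<^sub>R axis i 1)) 0"

definition has_pderiv_at :: "'n \<Rightarrow> (real ^ 'n \<Rightarrow> real) \<Rightarrow> real ^ 'n \<Rightarrow> bool" where
  "has_pderiv_at i f x \<longleftrightarrow> (\<lambda>s. f (x + s *\<^sub>R axis i 1)) field_differentiable at 0"

definition grad :: "(real ^ 'n \<Rightarrow> real) \<Rightarrow> real ^ 'n \<Rightarrow> real ^ 'n" where
  "grad f x = (\<chi> i. pderiv_at i f x)"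

definition laplacian :: "(real ^ 'n \<Rightarrow> real) \<Rightarrow> real ^ 'n \<Rightarrow> real" where
  "laplacian f x = (\<Sum>i\<in>UNIV. pderiv_at i (pderiv_at i f) x)"

text \<open>A function \<open>u(x,t)\<close> is written \<open>u x t\<close>. Its time derivative is one-sided at \<open>t = 0\<close>
  and the ordinary derivative at \<open>t > 0\<close>.\<close>

definition dt :: "(real ^ 'n \<Rightarrow> real \<Rightarrow> real) \<Rightarrow> real ^ 'n \<Rightarrow> real \<Rightarrow> real" where
  "dt u x t = vector_derivative (u x) (at t within {0..})"

definition time_interval :: "ereal \<Rightarrow> real set" where
  "time_interval S = {t. 0 \<le> t \<and> ereal t < S}"

definition C21 :: "(real ^ 'n) set \<Rightarrow> ereal \<Rightarrow> (real ^ 'n \<Rightarrow> real \<Rightarrow> real) \<Rightarrow> bool" where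
  "C21 \<Omega> S u \<longleftrightarrow>
     (\<forall>x\<in>\<Omega>. \<forall>t\<in>time_interval S. \<forall>i j.
        has_pderiv_at i (\<lambda>y. u y t) x \<and>
        has_pderiv_at j (pderiv_at i (\<lambda>y. u y t)) x \<and>
        u x differentiable (at t within {0..})) \<and>
     continuous_on (\<Omega> \<times> time_interval S) (\<lambda>(x, t). u x t) \<and>
     continuous_on (\<Omega> \<times> time_interval S) (\<lambda>(x, t). dt u x t) \<and>
     (\<forall>i. continuous_on (\<Omega> \<times> time_interval S) (\<lambda>(x, t). pderiv_at i (\<lambda>y. u y t) x)) \<and>
     (\<forall>i j. continuous_on (\<Omega> \<times> time_interval S)
        (\<lambda>(x, t). pderiv_at j (pderiv_at i (\<lambda>y. u y t)) x))"

subsection \<open>The parabolic problem and quenching\<close>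

text \<open>Classical solutions on \<open>\<Omega> \<times> [0,S)\<close>, with \<open>S = \<infinity>\<close> allowed. The bound \<open>u < 1\<close> expresses
  that the right-hand side is defined: the solution starts at \<open>0\<close> and cannot cross the
  singularity \<open>u = 1\<close>, where division in HOL would return \<open>0\<close>. No regularity of the
  derivatives up to the lateral boundary is required.\<close>

definition solution ::
  "real \<Rightarrow> real \<Rightarrow> (real ^ 'n) set \<Rightarrow> ereal \<Rightarrow> (real ^ 'n \<Rightarrow> real \<Rightarrow> real) \<Rightarrow> bool" where
  "solution \<mu> \<delta> \<Omega> S u \<longleftrightarrow>
     0 < S \<and>
     C21 \<Omega> S u \<and>
     continuous_on (closure \<Omega> \<times> time_interval S) (\<lambda>(x, t). u x t) \<and>
     (\<forall>x\<in>\<Omega>. \<forall>t\<in>time_interval S. u x t < 1) \<and>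
     (\<forall>x\<in>\<Omega>. \<forall>t\<in>time_interval S.
        dt u x t - laplacian (\<lambda>y. u y t) x =
          \<mu> * (1 + \<delta> * (norm (grad (\<lambda>y. u y t) x))\<^sup>2) / (1 - u x t)\<^sup>2) \<and>
     (\<forall>x\<in>frontier \<Omega>. \<forall>t\<in>time_interval S. u x t = 0) \<and>
     (\<forall>x\<in>\<Omega>. u x 0 = 0)"

text \<open>The quenching time presupposes that \<open>u\<close> is continued as long as possible: otherwise any
  restriction of a solution to a shorter time interval would count as quenching.\<close>

definition maximal_solution ::
  "real \<Rightarrow> real \<Rightarrow> (real ^ 'n) set \<Rightarrow> ereal \<Rightarrow> (real ^ 'n \<Rightarrow> real \<Rightarrow> real) \<Rightarrow> bool" where
  "maximal_solution \<mu> \<delta> \<Omega> S u \<longleftrightarrow>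
     solution \<mu> \<delta> \<Omega> S u \<and>
     (\<forall>S' v. solution \<mu> \<delta> \<Omega> S' v \<and> (\<forall>x\<in>\<Omega>. \<forall>t\<in>time_interval S \<inter> time_interval S'. v x t = u x t) \<longrightarrow> S' \<le> S)"

definition sup_norm :: "(real ^ 'n) set \<Rightarrow> (real ^ 'n \<Rightarrow> real) \<Rightarrow> ereal" where
  "sup_norm \<Omega> f = (SUP x\<in>\<Omega>. ereal \<bar>f x\<bar>)"

text \<open>Only times in the existence interval \<open>[0,S)\<close> of \<open>u\<close> count; the values of the total
  function \<open>u\<close> at later times have no meaning.\<close>

definition quenching_time ::
  "(real ^ 'n) set \<Rightarrow> ereal \<Rightarrow> (real ^ 'n \<Rightarrow> real \<Rightarrow> real) \<Rightarrow> ereal" where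
  "quenching_time \<Omega> S u =
     Sup {ereal t | t. 0 < t \<and> t \<in> time_interval S \<and> (\<forall>\<tau>\<in>{0..t}. sup_norm \<Omega> (\<lambda>x. u x \<tau>) < 1)}"

definition dt_blows_up_at_quenching ::
  "(real ^ 'n) set \<Rightarrow> real \<Rightarrow> (real ^ 'n \<Rightarrow> real \<Rightarrow> real) \<Rightarrow> bool" where
  "dt_blows_up_at_quenching \<Omega> T u \<longleftrightarrow>
     (\<forall>(x :: nat \<Rightarrow> real ^ 'n) (t :: nat \<Rightarrow> real).
        (\<forall>k. x k \<in> \<Omega> \<and> t k \<in> {0..<T}) \<and> t \<longlonglongrightarrow> T \<and> (\<lambda>k. u (x k) (t k)) \<longlonglongrightarrow> 1 \<longrightarrow>
        filterlim (\<lambda>k. dt u (x k) (t k)) at_top sequentially)"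

end

theory Submission
  imports Defs
begin

text \<open>Both claims follow from \<open>u\<^sub>t \<ge> \<epsilon> / (1 - u)\<^sup>2\<close> for \<open>u\<close> close to \<open>1\<close>, uniformly in \<open>\<Omega>\<close> and up to the quenching
  time (\<open>dt_lower_bound\<close>): integrating it in time bounds \<open>(1 - u)\<^sup>3\<close> below by a multiple of \<open>T - t\<close>, and
  the blow-up of \<open>u\<^sub>t\<close> is immediate.

  To obtain this bound, put \<open>v = H u\<close> with \<open>H' = exp (\<mu> \<delta> / (1 - u))\<close>. This removes the gradient term and
  leaves \<open>v\<^sub>t = \<Delta>v + F v\<close> with \<open>F\<close> convex. The time derivative of \<open>v\<close> formally solves the linearized equation
  \<open>w\<^sub>t = \<Delta>w + F' (v) w\<close>; since it need not be regular enough for a maximum principle, it is replaced by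
  difference quotients in time, which by convexity are supersolutions (\<open>quot_evolution\<close>). They are
  nonnegative, and bounded below by a positive constant on compact subsets of \<open>\<Omega>\<close>.

  The comparison function is \<open>\<epsilon> (growth (u) - B \<zeta>)\<close>. Here \<open>growth\<close> is slightly larger than \<open>F\<close> near the
  singularity, convex in \<open>v\<close>, zero at \<open>u = 0\<close>, and chosen such that \<open>growth (u)\<close> minus any constant is a
  subsolution of the linearized equation where \<open>u\<close> is close to \<open>1\<close>. The barrier \<open>\<zeta>\<close> is a concave function
  of the distance to the boundary, with \<open>- \<Delta>\<zeta> \<ge> 1\<close> in the sense of touching functions, and repairs the subsolution property near the
  boundary, where \<open>u\<close> may be small and no positive lower bound for \<open>v\<^sub>t\<close> is available. Since \<open>\<zeta>\<close> is
  bounded, it costs only a constant in the result (\<open>quot_ge_growth\<close>), and therefore the bound for \<open>u\<^sub>t\<close>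
  holds up to the boundary without a separate proof that quenching takes place inside \<open>\<Omega>\<close>.
  Convexity of \<open>\<Omega>\<close> enters through \<open>\<zeta>\<close>: at each point a hyperplane that supports \<open>\<Omega>\<close> at the nearest
  boundary point yields a smooth function that touches \<open>\<zeta>\<close> from above (\<open>barrier_touched\<close>).\<close>

section \<open>Second derivatives along coordinate lines\<close>

text \<open>The hypotheses on \<open>u\<close> speak of derivatives along coordinate lines. Accordingly the gradient and the
  Laplacian are handled through one-variable functions: \<open>has_d2 g a b\<close> says that \<open>g\<close> has first
  derivative \<open>a\<close> and second derivative \<open>b\<close> at \<open>0\<close>.\<close>

definition has_d2 :: "(real \<Rightarrow> real) \<Rightarrow> real \<Rightarrow> real \<Rightarrow> bool" where
  "has_d2 g a b \<longleftrightarrow> (\<exists>g1. (\<forall>\<^sub>F s in nhds 0. (g has_real_derivative g1 s) (at s)) \<and>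
     g1 0 = a \<and> (g1 has_real_derivative b) (at 0))"

lemma has_d2_linear:
  assumes "has_d2 g a b" "has_d2 g' a' b'"
  shows "has_d2 (\<lambda>s. c * g s + c' * g' s) (c * a + c' * a') (c * b + c' * b')"
proof -
  obtain g1 where g1: "\<forall>\<^sub>F s in nhds 0. (g has_real_derivative g1 s) (at s)" "g1 0 = a"
    "(g1 has_real_derivative b) (at 0)" using assms(1) unfolding has_d2_def by blast
  obtain g2 where g2: "\<forall>\<^sub>F s in nhds 0. (g' has_real_derivative g2 s) (at s)" "g2 0 = a'"
    "(g2 has_real_derivative b') (at 0)" using assms(2) unfolding has_d2_def by blast
  show ?thesis unfolding has_d2_def
  proof (intro exI conjI)
    show "\<forall>\<^sub>F s in nhds 0. ((\<lambda>s. c * g s + c' * g' s) has_real_derivative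
        (\<lambda>s. c * g1 s + c' * g2 s) s) (at s)"
      using g1(1) g2(1) by eventually_elim (auto intro!: derivative_eq_intros)
    show "((\<lambda>s. c * g1 s + c' * g2 s) has_real_derivative c * b + c' * b') (at 0)"
      using g1(3) g2(3) by (auto intro!: derivative_eq_intros)
  qed (use g1 g2 in auto)
qed

lemma has_d2_compose:
  assumes "has_d2 g a b" "open A" "g 0 \<in> A"
    and F: "\<And>r. r \<in> A \<Longrightarrow> (F has_real_derivative F1 r) (at r)"
    and F2: "(F1 has_real_derivative f2) (at (g 0))"
  shows "has_d2 (\<lambda>s. F (g s)) (F1 (g 0) * a) (f2 * a\<^sup>2 + F1 (g 0) * b)"
proof -
  obtain g1 where g1: "\<forall>\<^sub>F s in nhds 0. (g has_real_derivative g1 s) (at s)" "g1 0 = a"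
    "(g1 has_real_derivative b) (at 0)" using assms(1) unfolding has_d2_def by blast
  have g0: "(g has_real_derivative a) (at 0)"
    using eventually_nhds_x_imp_x[OF g1(1)] g1(2) by simp
  then have "isCont g 0" by (rule DERIV_isCont)
  then have "\<forall>\<^sub>F s in nhds 0. g s \<in> A"
    using assms(2,3) by (simp add: continuous_at_open eventually_nhds)
  then have ev: "\<forall>\<^sub>F s in nhds 0. ((\<lambda>s. F (g s)) has_real_derivative F1 (g s) * g1 s) (at s)"
    using g1(1) by eventually_elim (rule DERIV_chain2[OF F])
  show ?thesis unfolding has_d2_def
  proof (intro exI conjI)
    show "((\<lambda>s. F1 (g s) * g1 s) has_real_derivative f2 * a\<^sup>2 + F1 (g 0) * b) (at 0)"
      by (rule DERIV_cong[OF DERIV_mult[OF DERIV_chain2[OF F2 g0] g1(3)]])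
        (simp add: g1(2) power2_eq_square algebra_simps)
  qed (use ev g1 in auto)
qed

lemma has_d2_local_min:
  assumes "has_d2 g a b" and min: "\<forall>\<^sub>F s in nhds 0. g 0 \<le> g s"
  shows "0 \<le> b"
proof (rule ccontr)
  assume "\<not> 0 \<le> b"
  obtain g1 where g1: "\<forall>\<^sub>F s in nhds 0. (g has_real_derivative g1 s) (at s)" "g1 0 = a"
    "(g1 has_real_derivative b) (at 0)" using assms(1) unfolding has_d2_def by blast
  obtain e where e: "e > 0" "\<And>s. \<bar>s\<bar> < e \<Longrightarrow> (g has_real_derivative g1 s) (at s) \<and> g 0 \<le> g s"
    using eventually_conj[OF g1(1) min] by (auto simp: eventually_nhds_metric dist_real_def)
  have "g1 0 = 0"
    using DERIV_local_min[of g "g1 0" 0 e] e by auto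
  then obtain d where d: "d > 0" "\<And>h. 0 < h \<Longrightarrow> h < d \<Longrightarrow> g1 h < 0"
    using DERIV_neg_dec_right[OF g1(3)] \<open>\<not> 0 \<le> b\<close> by auto
  define r where "r = min d e / 2"
  have r: "0 < r" "r < d" "r < e" using d e by (auto simp: r_def)
  have "\<exists>z>0. z < r \<and> g r - g 0 = (r - 0) * g1 z"
    by (rule MVT2) (use r e in auto)
  then obtain z where z: "0 < z" "z < r" "g r - g 0 = r * g1 z" by auto
  have "g1 z < 0" using d(2) z r by simp
  then have "g r < g 0" using z r by (smt (verit) mult_pos_neg)
  then show False using e(2)[of r] r by simp
qed

text \<open>The data \<open>p\<close> and \<open>L\<close> are the gradient and the Laplacian of \<open>z\<close> at \<open>x\<close>.\<close>

definition has_lap :: "(real ^ 'n \<Rightarrow> real) \<Rightarrow> real ^ 'n \<Rightarrow> real ^ 'n \<Rightarrow> real \<Rightarrow> bool" where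
  "has_lap z x p L \<longleftrightarrow> (\<exists>q. (\<forall>i. has_d2 (\<lambda>s. z (x + s *\<^sub>R axis i 1)) (p $ i) (q i)) \<and>
     L = (\<Sum>i\<in>UNIV. q i))"

lemma has_lap_linear:
  assumes "has_lap z x p L" "has_lap z' x p' L'"
  shows "has_lap (\<lambda>y. c * z y + c' * z' y) x (c *\<^sub>R p + c' *\<^sub>R p') (c * L + c' * L')"
proof -
  obtain q q' where "\<forall>i. has_d2 (\<lambda>s. z (x + s *\<^sub>R axis i 1)) (p $ i) (q i)" "L = (\<Sum>i\<in>UNIV. q i)"
    "\<forall>i. has_d2 (\<lambda>s. z' (x + s *\<^sub>R axis i 1)) (p' $ i) (q' i)" "L' = (\<Sum>i\<in>UNIV. q' i)"
    using assms unfolding has_lap_def by blast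
  then show ?thesis unfolding has_lap_def
    by (intro exI[of _ "\<lambda>i. c * q i + c' * q' i"])
       (auto intro!: has_d2_linear simp: sum.distrib sum_distrib_left)
qed

lemma has_lap_compose:
  assumes "has_lap z x p L" "open A" "z x \<in> A"
    and F: "\<And>r. r \<in> A \<Longrightarrow> (F has_real_derivative F1 r) (at r)"
    and F2: "(F1 has_real_derivative f2) (at (z x))"
  shows "has_lap (\<lambda>y. F (z y)) x (F1 (z x) *\<^sub>R p) (f2 * (norm p)\<^sup>2 + F1 (z x) * L)"
proof -
  obtain q where q: "\<And>i. has_d2 (\<lambda>s. z (x + s *\<^sub>R axis i 1)) (p $ i) (q i)" "L = (\<Sum>i\<in>UNIV. q i)"
    using assms(1) unfolding has_lap_def by blast
  have "has_d2 (\<lambda>s. F (z (x + s *\<^sub>R axis i 1))) (F1 (z x) * p $ i) (f2 * (p $ i)\<^sup>2 + F1 (z x) * q i)" for i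
    using has_d2_compose[OF q(1)[of i] assms(2), of F F1 f2] assms(3) F F2 by simp
  then show ?thesis unfolding has_lap_def
    by (intro exI[of _ "\<lambda>i. f2 * (p $ i)\<^sup>2 + F1 (z x) * q i"])
      (auto simp: q(2) sum.distrib sum_distrib_left norm_vec_def L2_set_def sum_nonneg)
qed

lemma has_lap_quadratic:
  fixes a b :: "real ^ 'n"
  shows "has_lap (\<lambda>y. m * (norm (y - b))\<^sup>2 + a \<bullet> y + c) x ((2 * m) *\<^sub>R (x - b) + a) (2 * m * real CARD('n))"
proof -
  have "has_d2 (\<lambda>s. m * (norm (x + s *\<^sub>R axis i 1 - b))\<^sup>2 + a \<bullet> (x + s *\<^sub>R axis i 1) + c)
      (((2 * m) *\<^sub>R (x - b) + a) $ i) (2 * m)" for i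
  proof -
    have eq: "m * (norm (x + s *\<^sub>R axis i 1 - b))\<^sup>2 + a \<bullet> (x + s *\<^sub>R axis i 1) + c =
       m * ((norm (x - b))\<^sup>2 + 2 * s * (x - b) $ i + s\<^sup>2) + a \<bullet> x + s * a $ i + c" for s
    proof -
      have "x + s *\<^sub>R axis i 1 - b = (x - b) + s *\<^sub>R axis i 1" by simp
      then have "(norm (x + s *\<^sub>R axis i 1 - b))\<^sup>2 = (norm (x - b))\<^sup>2 + 2 * s * (x - b) $ i + s\<^sup>2"
        by (simp only: power2_norm_eq_inner)
          (simp add: inner_add_left inner_add_right inner_axis inner_axis' power2_eq_square algebra_simps)
      then show ?thesis by (simp add: inner_add_right inner_axis)
    qed
    show ?thesis unfolding has_d2_def eq
      by (intro exI[of _ "\<lambda>s. m * (2 * (x - b) $ i + 2 * s) + a $ i"] conjI always_eventually allI)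
        (auto intro!: derivative_eq_intros simp: algebra_simps)
  qed
  then show ?thesis unfolding has_lap_def
    by (intro exI[of _ "\<lambda>i. 2 * m"]) auto
qed

section \<open>A minimum principle\<close>

text \<open>The inequality \<open>z\<^sub>t - \<Delta>z \<ge> K z\<close> is needed only where \<open>z\<close> is negative, and only for a smooth
  function \<open>Z\<close> that touches \<open>z\<close> from above there: at a negative minimum of \<open>exp (- (K + 1) t) z\<close> the
  function \<open>Z\<close> inherits the minimum, so that its Laplacian is nonnegative and \<open>Z\<^sub>t \<le> (K + 1) Z\<close>, which
  contradicts the inequality. Allowing \<open>Z\<close> instead of \<open>z\<close> is what makes the distance to the boundary
  of a convex set usable as a barrier, although it is not differentiable.\<close>

lemma parabolic_min_principle:
  fixes z :: "real ^ 'n \<Rightarrow> real \<Rightarrow> real"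
  assumes D: "open D" "bounded D"
    and cont: "continuous_on (closure D \<times> {0..\<tau>}) (\<lambda>(x, t). z x t)"
    and bdry: "\<And>x t. x \<in> frontier D \<Longrightarrow> 0 \<le> t \<Longrightarrow> t \<le> \<tau> \<Longrightarrow> 0 \<le> z x t"
    and init: "\<And>x. x \<in> D \<Longrightarrow> 0 \<le> z x 0"
    and super: "\<And>x t. x \<in> D \<Longrightarrow> 0 < t \<Longrightarrow> t \<le> \<tau> \<Longrightarrow> z x t < 0 \<Longrightarrow>
      \<exists>Z Zt p L. (\<forall>y\<in>D. \<forall>s\<in>{0..\<tau>}. z y s \<le> Z y s) \<and> Z x t = z x t \<and>
        (Z x has_real_derivative Zt) (at t) \<and> has_lap (\<lambda>y. Z y t) x p L \<and> K * z x t \<le> Zt - L"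
    and x: "x \<in> closure D" "0 \<le> t" "t \<le> \<tau>"
  shows "0 \<le> z x t"
proof (rule ccontr)
  assume neg: "\<not> 0 \<le> z x t"
  define P where "P = closure D \<times> {0..\<tau>}"
  define \<phi> where "\<phi> = (\<lambda>(x, t). exp (- (K + 1) * t) * z x t)"
  have "compact P" unfolding P_def using D by (intro compact_Times) auto
  moreover have "continuous_on P \<phi>"
    using continuous_on_mult[of P "\<lambda>q. exp (- (K + 1) * snd q)" "\<lambda>(x, t). z x t"] cont
    unfolding P_def \<phi>_def by (simp add: case_prod_beta) (intro continuous_intros)
  moreover have "(x, t) \<in> P" using x by (simp add: P_def)
  ultimately obtain q where q: "q \<in> P" "\<And>r. r \<in> P \<Longrightarrow> \<phi> q \<le> \<phi> r"
    using continuous_attains_inf[of P \<phi>] by blast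
  obtain x0 t0 where q0: "q = (x0, t0)" by (cases q)
  have "\<phi> q \<le> \<phi> (x, t)" using q \<open>(x, t) \<in> P\<close> by blast
  also have "\<dots> < 0" using neg by (simp add: \<phi>_def mult_pos_neg)
  finally have z0: "z x0 t0 < 0" by (auto simp: \<phi>_def q0 mult_less_0_iff)
  have t0: "0 \<le> t0" "t0 \<le> \<tau>" and "x0 \<in> closure D" using q by (auto simp: P_def q0)
  then have x0: "x0 \<in> D"
    using bdry[of x0 t0] z0 D by (auto simp: frontier_def interior_open)
  then have t00: "0 < t0" using init[of x0] z0 t0 by (cases "t0 = 0") auto
  from super[OF x0 t00 t0(2) z0] obtain Z Zt p L where
    Z: "\<And>y s. y \<in> D \<Longrightarrow> s \<in> {0..\<tau>} \<Longrightarrow> z y s \<le> Z y s" "Z x0 t0 = z x0 t0"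
       "(Z x0 has_real_derivative Zt) (at t0)" "has_lap (\<lambda>y. Z y t0) x0 p L" "K * z x0 t0 \<le> Zt - L"
    by blast
  have le: "exp (- (K + 1) * t0) * Z x0 t0 \<le> exp (- (K + 1) * s) * Z y s"
    if "y \<in> D" "s \<in> {0..\<tau>}" for y s
  proof -
    have "(y, s) \<in> P" using that closure_subset by (auto simp: P_def)
    then have "exp (- (K + 1) * t0) * Z x0 t0 \<le> exp (- (K + 1) * s) * z y s"
      using q(2)[of "(y, s)"] Z(2) by (simp add: \<phi>_def q0)
    also have "\<dots> \<le> exp (- (K + 1) * s) * Z y s" using Z(1)[OF that] by simp
    finally show ?thesis .
  qed
  obtain r where r: "\<And>i. has_d2 (\<lambda>s. Z (x0 + s *\<^sub>R axis i 1) t0) (p $ i) (r i)" "L = (\<Sum>i\<in>UNIV. r i)"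
    using Z(4) unfolding has_lap_def by blast
  have "0 \<le> r i" for i
  proof (rule has_d2_local_min[OF r(1)])
    have "((\<lambda>s. x0 + s *\<^sub>R axis i 1) \<longlongrightarrow> x0 + 0 *\<^sub>R axis i 1) (nhds (0::real))"
      by (intro tendsto_intros filterlim_ident)
    then have "\<forall>\<^sub>F s in nhds (0::real). x0 + s *\<^sub>R axis i 1 \<in> D"
      using topological_tendstoD[OF _ D(1)] x0 by auto
    then show "\<forall>\<^sub>F s in nhds 0. Z (x0 + 0 *\<^sub>R axis i 1) t0 \<le> Z (x0 + s *\<^sub>R axis i 1) t0"
      by eventually_elim (use le[of _ t0] t0 in auto)
  qed
  then have "0 \<le> L" by (simp add: r(2) sum_nonneg)
  have der: "((\<lambda>s. exp (- (K + 1) * s) * Z x0 s) has_real_derivative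
      exp (- (K + 1) * t0) * (Zt - (K + 1) * Z x0 t0)) (at t0)"
    using Z(3) by (auto intro!: derivative_eq_intros simp: algebra_simps)
  have "Zt - (K + 1) * Z x0 t0 \<le> 0"
  proof (rule ccontr)
    assume "\<not> Zt - (K + 1) * Z x0 t0 \<le> 0"
    then obtain d where d: "d > 0" "\<And>h. 0 < h \<Longrightarrow> h < d \<Longrightarrow>
        exp (- (K + 1) * (t0 - h)) * Z x0 (t0 - h) < exp (- (K + 1) * t0) * Z x0 t0"
      using DERIV_pos_inc_left[OF der] by auto
    define h where "h = min d t0 / 2"
    have "0 < h" "h < d" "h < t0" using d t00 by (auto simp: h_def)
    then show False using d(2)[of h] le[OF x0, of "t0 - h"] t0 by auto
  qed
  then have "Zt - L \<le> (K + 1) * z x0 t0" using \<open>0 \<le> L\<close> Z(2) by simp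
  also have "\<dots> < K * z x0 t0" using z0 by (simp add: algebra_simps)
  finally show False using Z(5) by simp
qed

section \<open>The change of variable and its nonlinearities\<close>

definition recip_gap :: "real \<Rightarrow> real" where "recip_gap r = 1 / (1 - r)"

lemma recip_gap_pos: "r < 1 \<Longrightarrow> 0 < recip_gap r"
  by (simp add: recip_gap_def)

lemma recip_gap_mono: "r \<le> s \<Longrightarrow> s < 1 \<Longrightarrow> recip_gap r \<le> recip_gap s"
  by (simp add: recip_gap_def frac_le)

lemma recip_gap_ge_1: "0 \<le> r \<Longrightarrow> r < 1 \<Longrightarrow> 1 \<le> recip_gap r"
  by (simp add: recip_gap_def)

lemma DERIV_recip_gap [derivative_intros]:
  assumes "(g has_real_derivative g') (at x within A)" "g x < 1"
  shows "((\<lambda>x. recip_gap (g x)) has_real_derivative (recip_gap (g x))\<^sup>2 * g') (at x within A)"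
  using assms unfolding recip_gap_def
  by (auto intro!: derivative_eq_intros simp: power2_eq_square)

text \<open>If \<open>H' = exp (k / (1 - r))\<close> with \<open>k = \<mu> \<delta>\<close>, then \<open>H'' = k / (1 - r)\<^sup>2 H'\<close>. So in the equation of
  \<open>v = H u\<close> the quadratic gradient term cancels and \<open>v\<^sub>t = \<Delta>v + F v\<close>, where
  \<open>F (H r) = source \<mu> k r\<close> below. Since \<open>u\<close> takes the value \<open>0\<close>, the
  derivative must exist on both sides of \<open>0\<close>; the left end \<open>- 1\<close> is otherwise arbitrary.\<close>

lemma linearizing_function_exists:
  "\<exists>H. H 0 = 0 \<and> (\<forall>r\<in>{-1<..<1}. (H has_real_derivative exp (k * recip_gap r)) (at r))"
proof -
  define f where "f r = exp (k * recip_gap r)" for r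
  define H where "H r = integral {-1..r} f - integral {-1..0} f" for r
  have "(H has_real_derivative f r) (at r)" if r: "r \<in> {-1<..<1}" for r
  proof -
    have "continuous_on {-1..(1 + r) / 2} f" unfolding f_def recip_gap_def
      using r by (intro continuous_intros) (auto simp: field_simps)
    then have "((\<lambda>r. integral {-1..r} f) has_real_derivative f r) (at r within {-1..(1 + r) / 2})"
      by (rule integral_has_real_derivative) (use r in auto)
    moreover have "at r within {-1..(1 + r) / 2} = at r"
      by (rule at_within_interior) (use r in auto)
    ultimately show ?thesis unfolding H_def
      by (auto intro!: derivative_eq_intros)
  qed
  then show ?thesis by (intro exI[of _ H]) (auto simp: H_def f_def)
qed

definition source :: "real \<Rightarrow> real \<Rightarrow> real \<Rightarrow> real" where
  "source \<mu> k r = \<mu> * (recip_gap r)\<^sup>2 * exp (k * recip_gap r)"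

text \<open>This is \<open>F' (H r)\<close>, the derivative of the source with respect to \<open>v = H u\<close> and not to \<open>u\<close>.\<close>

definition source_slope :: "real \<Rightarrow> real \<Rightarrow> real \<Rightarrow> real" where
  "source_slope \<mu> k r = \<mu> * (k * recip_gap r ^ 4 + 2 * recip_gap r ^ 3)"

lemma DERIV_source:
  assumes "r < 1"
  shows "(source \<mu> k has_real_derivative source_slope \<mu> k r * exp (k * recip_gap r)) (at r)"
  unfolding source_def [abs_def] source_slope_def
  by (rule derivative_eq_intros refl assms)+ (simp add: field_simps eval_nat_numeral)

lemma source_slope_mono:
  assumes "0 < \<mu>" "0 < k" "r \<le> s" "s < 1"
  shows "source_slope \<mu> k r \<le> source_slope \<mu> k s"
proof -
  have "0 \<le> recip_gap r" "recip_gap r \<le> recip_gap s"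
    using recip_gap_pos[of r] recip_gap_mono assms by auto
  then show ?thesis unfolding source_slope_def using assms
    by (intro mult_left_mono add_mono power_mono) auto
qed

lemma source_slope_nonneg:
  assumes "0 < \<mu>" "0 < k" "r < 1"
  shows "0 \<le> source_slope \<mu> k r"
  using recip_gap_pos[of r] assms unfolding source_slope_def by simp

text \<open>Convexity of \<open>F\<close>, written in the variable \<open>r\<close>: it holds because \<open>F' (H r)\<close> increases with \<open>r\<close>.\<close>

lemma source_convex:
  assumes H: "\<And>r. r \<in> {-1<..<1} \<Longrightarrow> (H has_real_derivative exp (k * recip_gap r)) (at r)"
    and pos: "0 < \<mu>" "0 < k" and r: "r \<in> {-1<..<1}" and s: "s \<in> {-1<..<1}"
  shows "source_slope \<mu> k r * (H s - H r) \<le> source \<mu> k s - source \<mu> k r"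
proof -
  define \<psi> where "\<psi> q = source \<mu> k q - source_slope \<mu> k r * H q" for q
  have der: "(\<psi> has_real_derivative (source_slope \<mu> k q - source_slope \<mu> k r) * exp (k * recip_gap q)) (at q)"
    if "q \<in> {-1<..<1}" for q
    unfolding \<psi>_def using that
    by (auto intro!: derivative_eq_intros DERIV_source H simp: algebra_simps)
  have "\<psi> r \<le> \<psi> s"
  proof (cases "r \<le> s")
    case True
    show ?thesis
    proof (rule DERIV_nonneg_imp_nondecreasing[OF True])
      fix q assume q: "r \<le> q" "q \<le> s"
      have "source_slope \<mu> k r \<le> source_slope \<mu> k q"
        using source_slope_mono[OF pos, of r q] q s by auto
      then show "\<exists>y. (\<psi> has_real_derivative y) (at q) \<and> 0 \<le> y"
        using der[of q] q r s by (intro exI[of _ "(source_slope \<mu> k q - source_slope \<mu> k r) * exp (k * recip_gap q)"]) auto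
    qed
  next
    case False
    show ?thesis
    proof (rule DERIV_nonpos_imp_nonincreasing[of s r \<psi>])
      show "s \<le> r" using False by simp
      fix q assume q: "s \<le> q" "q \<le> r"
      have "source_slope \<mu> k q \<le> source_slope \<mu> k r"
        using source_slope_mono[OF pos, of q r] q r by auto
      then show "\<exists>y. (\<psi> has_real_derivative y) (at q) \<and> y \<le> 0"
        using der[of q] q r s by (intro exI[of _ "(source_slope \<mu> k q - source_slope \<mu> k r) * exp (k * recip_gap q)"])
          (auto simp: mult_nonpos_nonneg)
    qed
  qed
  then show ?thesis by (simp add: \<psi>_def algebra_simps)
qed

text \<open>A comparison function for \<open>v\<^sub>t\<close>. Up to the constant, which makes it vanish at \<open>0\<close>, it is \<open>F / \<mu>\<close> with the
  factor \<open>1 / (1 - r)\<^sup>2\<close> replaced by \<open>1 / (1 - r)\<^sup>2 + 1 / (1 - r)\<close>. It is still at least of the order of \<open>F\<close>, but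
  the lower order term makes \<open>growth / F\<close> decrease near \<open>r = 1\<close>.\<close>

definition growth :: "real \<Rightarrow> real \<Rightarrow> real" where
  "growth k r = exp (k * recip_gap r) * ((recip_gap r)\<^sup>2 + recip_gap r) - 2 * exp k"

definition growth' :: "real \<Rightarrow> real \<Rightarrow> real" where
  "growth' k r = exp (k * recip_gap r) *
     (k * recip_gap r ^ 4 + (k + 2) * recip_gap r ^ 3 + recip_gap r ^ 2)"

definition growth'' :: "real \<Rightarrow> real \<Rightarrow> real" where
  "growth'' k r = k * (recip_gap r)\<^sup>2 * growth' k r + (recip_gap r)\<^sup>2 * exp (k * recip_gap r) *
     (4 * k * recip_gap r ^ 3 + 3 * (k + 2) * recip_gap r ^ 2 + 2 * recip_gap r)"

lemma growth_0: "growth k 0 = 0"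
  by (simp add: growth_def recip_gap_def)

lemma DERIV_growth: "r < 1 \<Longrightarrow> (growth k has_real_derivative growth' k r) (at r)"
  unfolding growth_def [abs_def] growth'_def
  by (rule derivative_eq_intros refl | assumption)+ (simp add: algebra_simps eval_nat_numeral)

lemma DERIV_growth': "r < 1 \<Longrightarrow> (growth' k has_real_derivative growth'' k r) (at r)"
  unfolding growth'_def [abs_def] growth''_def
  by (rule derivative_eq_intros refl | assumption)+ (simp add: algebra_simps eval_nat_numeral)

text \<open>In the variable \<open>v\<close> this says that \<open>growth\<close> is convex; it gives the gradient terms a good sign.\<close>

lemma growth''_ge:
  assumes "0 < k" "r < 1"
  shows "k * (recip_gap r)\<^sup>2 * growth' k r \<le> growth'' k r"
  using recip_gap_pos[OF assms(2)] assms unfolding growth''_def by simp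

lemma growth_mono:
  assumes "0 < k" "r \<le> s" "s < 1"
  shows "growth k r \<le> growth k s"
proof (rule DERIV_nonneg_imp_nondecreasing[OF assms(2)])
  fix q assume "r \<le> q" "q \<le> s"
  then show "\<exists>y. (growth k has_real_derivative y) (at q) \<and> 0 \<le> y"
    using assms recip_gap_pos[of q]
    by (intro exI[of _ "growth' k q"] conjI DERIV_growth) (auto simp: growth'_def)
qed

text \<open>Along a solution, \<open>growth (u)\<close> satisfies \<open>g\<^sub>t - \<Delta>g \<le> \<mu> / (1 - u)\<^sup>2 growth' (u)\<close>. Hence near \<open>r = 1\<close> this
  inequality makes \<open>growth (u) - C\<close> a subsolution of the linearized equation \<open>w\<^sub>t = \<Delta>w + F' (v) w\<close>,
  whatever the constant \<open>C\<close>. It holds because with \<open>Y = 1 / (1 - r)\<close> the two sides differ by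
  \<open>\<mu> Y\<^sup>2 (Y\<^sup>2 exp (k Y) - (k Y\<^sup>2 + 2 Y) (C + 2 exp k))\<close>, where the exponential wins.\<close>

lemma growth_subsolution:
  assumes pos: "0 < \<mu>" "0 < k"
  shows "\<exists>r0. 0 \<le> r0 \<and> r0 < 1 \<and> (\<forall>r. r0 \<le> r \<and> r < 1 \<longrightarrow>
    \<mu> * (recip_gap r)\<^sup>2 * growth' k r \<le> source_slope \<mu> k r * (growth k r - C))"
proof -
  define C' where "C' = max 0 (C + 2 * exp k)"
  define Y0 where "Y0 = max 1 ((k + 2) * C' / k)"
  show ?thesis
  proof (intro exI[of _ "1 - 1 / Y0"] conjI allI impI)
    have "1 \<le> Y0" by (simp add: Y0_def)
    then show "0 \<le> 1 - 1 / Y0" "1 - 1 / Y0 < 1" by auto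
    fix r :: real assume r: "1 - 1 / Y0 \<le> r \<and> r < 1"
    define Y where "Y = recip_gap r"
    have "Y0 = recip_gap (1 - 1 / Y0)" using \<open>1 \<le> Y0\<close> by (simp add: recip_gap_def)
    also have "\<dots> \<le> Y" unfolding Y_def using r by (intro recip_gap_mono) auto
    finally have "Y0 \<le> Y" .
    then have Y: "1 \<le> Y" "(k + 2) * C' \<le> k * Y"
      using \<open>0 < k\<close> by (auto simp: Y0_def field_simps)
    have "C' \<ge> 0" by (simp add: C'_def)
    have "(k * Y\<^sup>2 + 2 * Y) * (C + 2 * exp k) \<le> (k * Y\<^sup>2 + 2 * Y) * C'"
      using Y pos by (intro mult_left_mono) (auto simp: C'_def)
    also have "\<dots> \<le> (k * Y\<^sup>2 + 2 * Y\<^sup>2) * C'"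
      using Y \<open>C' \<ge> 0\<close> by (intro mult_right_mono) (auto simp: power2_eq_square)
    also have "\<dots> = Y\<^sup>2 * ((k + 2) * C')" by (simp add: algebra_simps)
    also have "\<dots> \<le> Y\<^sup>2 * exp (k * Y)"
      using order_trans[OF Y(2), of "exp (k * Y)"] exp_ge_add_one_self[of "k * Y"]
      by (intro mult_left_mono zero_le_power2) linarith
    finally have "0 \<le> (\<mu> * Y\<^sup>2) * (Y\<^sup>2 * exp (k * Y) - (k * Y\<^sup>2 + 2 * Y) * (C + 2 * exp k))"
      using pos by simp
    also have "\<dots> = source_slope \<mu> k r * (growth k r - C) - \<mu> * Y\<^sup>2 * growth' k r"
      unfolding source_slope_def growth_def growth'_def Y_def[symmetric]
      by (simp add: algebra_simps eval_nat_numeral)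
    finally show "\<mu> * (recip_gap r)\<^sup>2 * growth' k r \<le> source_slope \<mu> k r * (growth k r - C)"
      by (simp add: Y_def)
  qed
qed

section \<open>Barriers and bumps\<close>

text \<open>A hyperplane that separates \<open>\<Omega>\<close> from the boundary point \<open>p\<close> nearest to \<open>x\<close> is at least as far from
  every \<open>y \<in> \<Omega>\<close> as the complement of \<open>\<Omega>\<close> is, and exactly as far from \<open>x\<close>.\<close>

lemma supporting_barrier:
  fixes \<Omega> :: "(real ^ 'n) set"
  assumes O: "open \<Omega>" "convex \<Omega>" "\<Omega> \<noteq> UNIV" and x: "x \<in> \<Omega>"
  obtains a p where "norm a = 1" "\<And>y. y \<in> \<Omega> \<Longrightarrow> infdist y (- \<Omega>) \<le> a \<bullet> (p - y)"
    "infdist x (- \<Omega>) = a \<bullet> (p - x)"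
proof -
  have "closed (- \<Omega>)" "- \<Omega> \<noteq> {}" using O by auto
  then obtain p where p: "p \<in> - \<Omega>" "infdist x (- \<Omega>) = dist x p"
    using infdist_attains_inf by blast
  obtain c b where cb: "c \<noteq> 0" "\<forall>y\<in>\<Omega>. c \<bullet> y \<le> b" "\<forall>y\<in>{p}. b \<le> c \<bullet> y"
    using separating_hyperplane_sets[of \<Omega> "{p}"] O(2) x p(1) by auto
  define a where "a = c /\<^sub>R norm c"
  have a: "norm a = 1" using cb by (simp add: a_def)
  have nonneg: "0 \<le> a \<bullet> (p - y)" if "y \<in> \<Omega>" for y
  proof -
    have "c \<bullet> y \<le> c \<bullet> p" using cb that by fastforce
    then have "0 \<le> c \<bullet> (p - y)" by (simp add: inner_diff_right)
    then show ?thesis by (simp add: a_def)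
  qed
  have le: "infdist y (- \<Omega>) \<le> a \<bullet> (p - y)" if y: "y \<in> \<Omega>" for y
  proof -
    define q where "q = y + (a \<bullet> (p - y)) *\<^sub>R a"
    have aq: "a \<bullet> (p - q) = 0"
      using a by (simp add: q_def inner_diff_right inner_add_right norm_eq_1)
    \<comment> \<open>The point \<open>q\<close> is the projection of \<open>y\<close> to the hyperplane, which the open set \<open>\<Omega>\<close> cannot meet.\<close>
    have "q \<notin> \<Omega>"
    proof
      assume "q \<in> \<Omega>"
      then obtain e where e: "e > 0" "ball q e \<subseteq> \<Omega>" using O(1) open_contains_ball by blast
      have "q + (e / 2) *\<^sub>R a \<in> \<Omega>" using e a by (intro subsetD[OF e(2)]) (simp add: dist_norm)
      from nonneg[OF this] show False
        using aq e a by (simp add: inner_diff_right inner_add_right norm_eq_1)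
    qed
    then have "infdist y (- \<Omega>) \<le> dist y q" by (intro infdist_le) auto
    also have "\<dots> = a \<bullet> (p - y)" using nonneg[OF y] a by (simp add: q_def dist_norm)
    finally show ?thesis .
  qed
  have "a \<bullet> (p - x) \<le> norm a * norm (p - x)" by (rule norm_cauchy_schwarz)
  then have "a \<bullet> (p - x) \<le> infdist x (- \<Omega>)" using a p(2) by (simp add: dist_norm norm_minus_commute)
  then show ?thesis using that[OF a le] le[OF x] by auto
qed

text \<open>For the distance \<open>s\<close> to a hyperplane, \<open>s (D - s) / 2\<close> solves \<open>- \<Delta>\<zeta> = 1\<close>. The width \<open>D\<close> is three times the
  diameter so that \<open>r (D - r) / 2\<close> is monotone between the distance to the boundary and the distance
  to a touching hyperplane.\<close>

definition barrier :: "(real ^ 'n) set \<Rightarrow> real ^ 'n \<Rightarrow> real" where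
  "barrier \<Omega> x = infdist x (- \<Omega>) * (3 * diameter \<Omega> - infdist x (- \<Omega>)) / 2"

lemma infdist_compl_le:
  fixes \<Omega> :: "(real ^ 'n) set"
  assumes "open \<Omega>" "bounded \<Omega>" "x \<in> \<Omega>"
  shows "infdist x (- \<Omega>) \<le> diameter \<Omega>"
proof -
  have "\<Omega> \<noteq> UNIV" using assms(2) not_bounded_UNIV by blast
  then have "frontier \<Omega> \<noteq> {}" using assms(3) frontier_not_empty by blast
  then obtain p where "p \<in> frontier \<Omega>" by blast
  then have p: "p \<in> - \<Omega>" "p \<in> closure \<Omega>"
    using assms(1) by (auto simp: frontier_def interior_open)
  have "infdist x (- \<Omega>) \<le> dist x p" using p by (rule_tac infdist_le)
  also have "\<dots> \<le> diameter (closure \<Omega>)"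
    using assms p closure_subset by (intro diameter_bounded_bound bounded_closure) auto
  finally show ?thesis using diameter_closure[OF assms(2)] by simp
qed

lemma barrier_touched:
  fixes \<Omega> :: "(real ^ 'n) set"
  assumes O: "open \<Omega>" "convex \<Omega>" "bounded \<Omega>" and x: "x \<in> \<Omega>"
  shows "\<exists>\<zeta> p. (\<forall>y\<in>\<Omega>. barrier \<Omega> y \<le> \<zeta> y) \<and> \<zeta> x = barrier \<Omega> x \<and> has_lap \<zeta> x p (- 1)"
proof -
  have "\<Omega> \<noteq> UNIV" using O(3) not_bounded_UNIV by blast
  then obtain a p where a: "norm a = 1" and le: "\<And>y. y \<in> \<Omega> \<Longrightarrow> infdist y (- \<Omega>) \<le> a \<bullet> (p - y)"
    and eq: "infdist x (- \<Omega>) = a \<bullet> (p - x)"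
    using supporting_barrier[OF O(1,2) _ x] by metis
  define \<Delta> where "\<Delta> = 3 * diameter \<Omega>"
  define s where "s y = 0 * (norm (y - 0))\<^sup>2 + (- a) \<bullet> y + a \<bullet> p" for y
  have s: "s y = a \<bullet> (p - y)" for y by (simp add: s_def inner_diff_right)
  define \<zeta> where "\<zeta> y = (\<lambda>r. r * (\<Delta> - r) / 2) (s y)" for y
  show ?thesis
  proof (intro exI conjI ballI)
    show "\<zeta> x = barrier \<Omega> x" by (simp add: \<zeta>_def s eq barrier_def \<Delta>_def)
    fix y assume y: "y \<in> \<Omega>"
    have "s y = s x + a \<bullet> (x - y)" by (simp add: s inner_diff_right)
    also have "a \<bullet> (x - y) \<le> norm a * norm (x - y)" by (rule norm_cauchy_schwarz)
    also have "norm a * norm (x - y) \<le> diameter \<Omega>"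
      using diameter_bounded_bound[OF O(3) x y] a by (simp add: dist_norm)
    also have "s x \<le> diameter \<Omega>" using infdist_compl_le[OF O(1,3) x] by (simp add: s eq)
    finally have "s y + infdist y (- \<Omega>) \<le> \<Delta>"
      using infdist_compl_le[OF O(1,3) y] by (simp add: \<Delta>_def)
    then have "0 \<le> (s y - infdist y (- \<Omega>)) * (\<Delta> - s y - infdist y (- \<Omega>))"
      using le[OF y] by (simp add: s)
    then show "barrier \<Omega> y \<le> \<zeta> y"
      by (simp add: barrier_def \<zeta>_def flip: \<Delta>_def) (simp add: algebra_simps)
  next
    have "has_lap s x ((2 * 0) *\<^sub>R (x - 0) + (- a)) (2 * 0 * real CARD('n))"
      unfolding s_def [abs_def] by (rule has_lap_quadratic)
    then have "has_lap s x (- a) 0" by simp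
    moreover have "((\<lambda>r. r * (\<Delta> - r) / 2) has_real_derivative (\<Delta> - 2 * r) / 2) (at r)" for r
      by (auto intro!: derivative_eq_intros simp: field_simps)
    moreover have "((\<lambda>r. (\<Delta> - 2 * r) / 2) has_real_derivative - 1) (at r)" for r
      by (auto intro!: derivative_eq_intros)
    ultimately have "has_lap (\<lambda>y. s y * (\<Delta> - s y) / 2) x (((\<Delta> - 2 * s x) / 2) *\<^sub>R (- a))
        (- 1 * (norm (- a))\<^sup>2 + (\<Delta> - 2 * s x) / 2 * 0)"
      by (rule has_lap_compose[OF _ open_UNIV UNIV_I])
    then show "has_lap \<zeta> x (((\<Delta> - 2 * s x) / 2) *\<^sub>R (- a)) (- 1)"
      using a by (simp add: \<zeta>_def [abs_def])
  qed
qed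

text \<open>Where the bump is small its Laplacian is positive, since the square makes the normal derivative
  vanish on the sphere as well; elsewhere a multiple of the bump dominates. The value of \<open>\<kappa>\<close> makes the
  sum a perfect square in \<open>q = \<rho>\<^sup>2 - \<bar>x - x0\<bar>\<^sup>2\<close>. Hence \<open>exp (- \<kappa> t)\<close> times the bump is a subsolution of the
  heat equation.\<close>

lemma bump_almost_eigenfunction:
  assumes \<rho>: "0 < \<rho>"
  shows "\<exists>\<kappa>>0. \<forall>x0 x :: real ^ 'n. \<exists>p L. has_lap (\<lambda>y. (\<rho>\<^sup>2 - (norm (y - x0))\<^sup>2)\<^sup>2) x p L \<and>
     0 \<le> \<kappa> * (\<rho>\<^sup>2 - (norm (x - x0))\<^sup>2)\<^sup>2 + L"
proof -
  define N where "N = 8 + 4 * real CARD('n)"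
  define \<kappa> where "\<kappa> = N\<^sup>2 / (32 * \<rho>\<^sup>2)"
  have N: "0 < N" by (simp add: N_def)
  show ?thesis
  proof (intro exI conjI allI)
    show "0 < \<kappa>" using N \<rho> by (simp add: \<kappa>_def)
    fix x0 x :: "real ^ 'n"
    define q where "q = \<rho>\<^sup>2 - (norm (x - x0))\<^sup>2"
    have 1: "has_lap (\<lambda>y. (- 1) * (norm (y - x0))\<^sup>2 + 0 \<bullet> y + \<rho>\<^sup>2) x
        ((2 * (- 1)) *\<^sub>R (x - x0) + 0) (2 * (- 1) * real CARD('n))"
      by (rule has_lap_quadratic)
    then have "has_lap (\<lambda>y. \<rho>\<^sup>2 - (norm (y - x0))\<^sup>2) x ((- 2) *\<^sub>R (x - x0)) (- 2 * real CARD('n))"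
      by (simp add: algebra_simps)
    moreover have "((\<lambda>r. r\<^sup>2) has_real_derivative 2 * r) (at r)" for r :: real
      by (auto intro!: derivative_eq_intros)
    moreover have "((\<lambda>r. 2 * r) has_real_derivative 2) (at r)" for r :: real
      by (auto intro!: derivative_eq_intros)
    ultimately show "has_lap (\<lambda>y. (\<rho>\<^sup>2 - (norm (y - x0))\<^sup>2)\<^sup>2) x ((2 * q) *\<^sub>R ((- 2) *\<^sub>R (x - x0)))
       (2 * (norm ((- 2) *\<^sub>R (x - x0)))\<^sup>2 + 2 * q * (- 2 * real CARD('n)))"
      unfolding q_def by (rule has_lap_compose[OF _ open_UNIV UNIV_I])
    have "norm ((- 2) *\<^sub>R (x - x0)) = 2 * norm (x - x0)" by simp
    then have "2 * (norm ((- 2) *\<^sub>R (x - x0)))\<^sup>2 + 2 * q * (- 2 * real CARD('n)) = 8 * \<rho>\<^sup>2 - N * q"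
      by (simp only: power_mult_distrib) (simp add: q_def N_def algebra_simps)
    moreover have "\<kappa> * q\<^sup>2 + (8 * \<rho>\<^sup>2 - N * q) = (N * q - 16 * \<rho>\<^sup>2)\<^sup>2 / (32 * \<rho>\<^sup>2)"
      using \<rho> by (simp add: \<kappa>_def field_simps power2_eq_square)
    ultimately show "0 \<le> \<kappa> * (\<rho>\<^sup>2 - (norm (x - x0))\<^sup>2)\<^sup>2 +
        (2 * (norm ((- 2) *\<^sub>R (x - x0)))\<^sup>2 + 2 * q * (- 2 * real CARD('n)))"
      by (simp add: q_def)
  qed
qed

section \<open>The semilinear form of the equation\<close>

lemma has_lap_of_derivatives:
  assumes "open \<Omega>" "x \<in> \<Omega>"
    and 1: "\<And>y i. y \<in> \<Omega> \<Longrightarrow> has_pderiv_at i z y"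
    and 2: "\<And>i. has_pderiv_at i (pderiv_at i z) x"
  shows "has_lap z x (grad z x) (laplacian z x)"
proof -
  have "has_d2 (\<lambda>s. z (x + s *\<^sub>R axis i 1)) (grad z x $ i) (pderiv_at i (pderiv_at i z) x)" for i
    unfolding has_d2_def
  proof (intro exI[of _ "\<lambda>s. pderiv_at i z (x + s *\<^sub>R axis i 1)"] conjI)
    have "((\<lambda>s. x + s *\<^sub>R axis i 1) \<longlongrightarrow> x + 0 *\<^sub>R axis i 1) (nhds (0::real))"
      by (intro tendsto_intros filterlim_ident)
    then have "\<forall>\<^sub>F s in nhds (0::real). x + s *\<^sub>R axis i 1 \<in> \<Omega>"
      using topological_tendstoD assms(1,2) by fastforce
    then show "\<forall>\<^sub>F s in nhds 0. ((\<lambda>s. z (x + s *\<^sub>R axis i 1)) has_real_derivative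
        pderiv_at i z (x + s *\<^sub>R axis i 1)) (at s)"
    proof eventually_elim
      fix s :: real assume "x + s *\<^sub>R axis i 1 \<in> \<Omega>"
      from 1[OF this, of i] have "((\<lambda>r. z (x + s *\<^sub>R axis i 1 + r *\<^sub>R axis i 1)) has_real_derivative
          pderiv_at i z (x + s *\<^sub>R axis i 1)) (at 0)"
        unfolding has_pderiv_at_def pderiv_at_def by (simp add: DERIV_deriv_iff_field_differentiable)
      then show "((\<lambda>s. z (x + s *\<^sub>R axis i 1)) has_real_derivative
          pderiv_at i z (x + s *\<^sub>R axis i 1)) (at s)"
        using DERIV_at_within_shift[of "\<lambda>s. z (x + s *\<^sub>R axis i 1)" _ s 0 UNIV]
        by (simp add: algebra_simps)
    qed
    show "((\<lambda>s. pderiv_at i z (x + s *\<^sub>R axis i 1)) has_real_derivative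
        pderiv_at i (pderiv_at i z) x) (at 0)"
      using 2[of i] unfolding has_pderiv_at_def pderiv_at_def[of i "pderiv_at i z"]
      by (simp add: DERIV_deriv_iff_field_differentiable)
  qed (simp add: grad_def)
  then show ?thesis unfolding has_lap_def laplacian_def
    by (intro exI[of _ "\<lambda>i. pderiv_at i (pderiv_at i z) x"]) simp
qed

text \<open>The antiderivative \<open>H\<close> is a parameter, so that all statements about \<open>v = H u\<close> refer to the same one;
  \<open>linearizing_function_exists\<close> provides it.\<close>

locale quenching_flow =
  fixes \<mu> \<delta> T :: real and S :: ereal
    and \<Omega> :: "(real ^ 'n) set" and u :: "real ^ 'n \<Rightarrow> real \<Rightarrow> real"
    and H :: "real \<Rightarrow> real"
  assumes \<mu>: "0 < \<mu>" and \<delta>: "0 < \<delta>"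
    and \<Omega>: "open \<Omega>" "convex \<Omega>" "bounded \<Omega>"
    and sol: "solution \<mu> \<delta> \<Omega> S u" and TS: "ereal T \<le> S"
    and H_0: "H 0 = 0"
    and DERIV_H: "\<And>r. r \<in> {-1<..<1} \<Longrightarrow> (H has_real_derivative exp (\<mu> * \<delta> * recip_gap r)) (at r)"
begin

definition k :: real where "k = \<mu> * \<delta>"

lemma k: "0 < k" using \<mu> \<delta> by (simp add: k_def)

lemma H: "r \<in> {-1<..<1} \<Longrightarrow> (H has_real_derivative exp (k * recip_gap r)) (at r)"
  using DERIV_H by (simp add: k_def)

lemma in_time_interval: "0 \<le> t \<Longrightarrow> t < T \<Longrightarrow> t \<in> time_interval S"
  using TS less_le_trans[of "ereal t" "ereal T" S] by (simp add: time_interval_def)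

lemma u_bdry: "x \<in> frontier \<Omega> \<Longrightarrow> 0 \<le> t \<Longrightarrow> t < T \<Longrightarrow> u x t = 0"
  using sol in_time_interval unfolding solution_def by blast

lemma u_init: "x \<in> closure \<Omega> \<Longrightarrow> 0 < T \<Longrightarrow> u x 0 = 0"
  using sol u_bdry[of x 0] \<Omega>(1) unfolding solution_def
  by (cases "x \<in> \<Omega>") (auto simp: frontier_def interior_open)

lemma u_less_1: "x \<in> closure \<Omega> \<Longrightarrow> 0 \<le> t \<Longrightarrow> t < T \<Longrightarrow> u x t < 1"
  using sol u_bdry[of x t] in_time_interval[of t] \<Omega>(1) unfolding solution_def
  by (cases "x \<in> \<Omega>") (auto simp: frontier_def interior_open)

lemma u_cont:
  assumes "\<tau> < T"
  shows "continuous_on (closure \<Omega> \<times> {0..\<tau>}) (\<lambda>(x, t). u x t)"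
proof (rule continuous_on_subset)
  show "continuous_on (closure \<Omega> \<times> time_interval S) (\<lambda>(x, t). u x t)"
    using sol by (simp add: solution_def)
  show "closure \<Omega> \<times> {0..\<tau>} \<subseteq> closure \<Omega> \<times> time_interval S"
    using in_time_interval assms by auto
qed

lemma u_evolution:
  assumes x: "x \<in> \<Omega>" and t: "0 \<le> t" "t < T"
  shows "has_lap (\<lambda>y. u y t) x (grad (\<lambda>y. u y t) x) (laplacian (\<lambda>y. u y t) x)"
    and "(u x has_real_derivative dt u x t) (at t within {0..})"
    and "dt u x t - laplacian (\<lambda>y. u y t) x =
      \<mu> * (recip_gap (u x t))\<^sup>2 * (1 + \<delta> * (norm (grad (\<lambda>y. u y t) x))\<^sup>2)"
proof -
  have C: "C21 \<Omega> S u" using sol by (simp add: solution_def)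
  have d: "has_pderiv_at i (\<lambda>y. u y t) y" "has_pderiv_at i (pderiv_at i (\<lambda>y. u y t)) y"
    "u y differentiable (at t within {0..})" if "y \<in> \<Omega>" for y i
    using C in_time_interval[OF t] that unfolding C21_def by metis+
  show "has_lap (\<lambda>y. u y t) x (grad (\<lambda>y. u y t) x) (laplacian (\<lambda>y. u y t) x)"
    using has_lap_of_derivatives[OF \<Omega>(1) x d(1) d(2)[OF x]] .
  show "(u x has_real_derivative dt u x t) (at t within {0..})"
    using d(3)[OF x] unfolding dt_def has_real_derivative_iff_has_vector_derivative
    by (simp only: vector_derivative_works)
  have "dt u x t - laplacian (\<lambda>y. u y t) x =
      \<mu> * (1 + \<delta> * (norm (grad (\<lambda>y. u y t) x))\<^sup>2) / (1 - u x t)\<^sup>2"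
    using sol in_time_interval[OF t] x unfolding solution_def by metis
  then show "dt u x t - laplacian (\<lambda>y. u y t) x =
      \<mu> * (recip_gap (u x t))\<^sup>2 * (1 + \<delta> * (norm (grad (\<lambda>y. u y t) x))\<^sup>2)"
    by (simp add: recip_gap_def power_divide)
qed

lemma DERIV_at_interior_time:
  assumes "(f has_real_derivative D) (at t within {0..})" "0 < t"
  shows "(f has_real_derivative D) (at t)"
  using assms at_within_interior[of t "{0..}"] by simp

lemma u_nonneg:
  assumes x: "x \<in> closure \<Omega>" and t: "0 \<le> t" "t < T"
  shows "0 \<le> u x t"
proof (rule parabolic_min_principle[OF \<Omega>(1,3) u_cont[OF t(2)] _ _ _ x t(1) order_refl])
  show "0 \<le> u y s" if "y \<in> frontier \<Omega>" "0 \<le> s" "s \<le> t" for y s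
    using u_bdry[of y s] that t by simp
  show "0 \<le> u y 0" if "y \<in> \<Omega>" for y
    using u_init[of y] that t closure_subset[of \<Omega>] by auto
  show "\<exists>Z Zt p L. (\<forall>y\<in>\<Omega>. \<forall>s\<in>{0..t}. u y s \<le> Z y s) \<and> Z y s = u y s \<and>
      (Z y has_real_derivative Zt) (at s) \<and> has_lap (\<lambda>y. Z y s) y p L \<and> 0 * u y s \<le> Zt - L"
    if "y \<in> \<Omega>" "0 < s" "s \<le> t" "u y s < 0" for y s
  proof (intro exI conjI)
    have s: "0 \<le> s" "s < T" using that t by auto
    show "(u y has_real_derivative dt u y s) (at s)"
      using u_evolution(2)[OF that(1) s] that by (intro DERIV_at_interior_time)
    show "has_lap (\<lambda>y. u y s) y (grad (\<lambda>y. u y s) y) (laplacian (\<lambda>y. u y s) y)"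
      by (rule u_evolution(1)[OF that(1) s])
    show "0 * u y s \<le> dt u y s - laplacian (\<lambda>y. u y s) y"
      using u_evolution(3)[OF that(1) s] \<mu> \<delta> by simp
  qed auto
qed

lemma u_range:
  assumes "x \<in> closure \<Omega>" "0 \<le> t" "t < T"
  shows "u x t \<in> {-1<..<1}" "u x t \<in> {0..<1}"
  using u_nonneg[OF assms] u_less_1[OF assms] by auto

lemma H_mono:
  assumes "r \<in> {-1<..<1}" "s \<in> {-1<..<1}" "r < s"
  shows "H r < H s"
proof (rule DERIV_pos_imp_increasing[OF assms(3)])
  fix q assume "r \<le> q" "q \<le> s"
  then have "(H has_real_derivative exp (k * recip_gap q)) (at q)" using assms by (intro H) auto
  then show "\<exists>y. (H has_real_derivative y) (at q) \<and> 0 < y" by (intro exI conjI) auto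
qed

lemma H_ge:
  assumes "0 \<le> r" "r < 1"
  shows "r \<le> H r"
proof -
  have "(\<lambda>s. H s - s) 0 \<le> (\<lambda>s. H s - s) r"
  proof (rule DERIV_nonneg_imp_nondecreasing[OF assms(1)])
    fix s assume s: "0 \<le> s" "s \<le> r"
    have "((\<lambda>s. H s - s) has_real_derivative exp (k * recip_gap s) - 1) (at s)"
      using s assms by (auto intro!: derivative_eq_intros H)
    moreover have "0 \<le> exp (k * recip_gap s) - 1"
      using k recip_gap_ge_1[of s] s assms by simp
    ultimately show "\<exists>y. ((\<lambda>s. H s - s) has_real_derivative y) (at s) \<and> 0 \<le> y" by blast
  qed
  then show ?thesis by (simp add: H_0)
qed

lemma closureI: "x \<in> \<Omega> \<Longrightarrow> x \<in> closure \<Omega>" using closure_subset by blast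

definition v :: "real ^ 'n \<Rightarrow> real \<Rightarrow> real" where "v x t = H (u x t)"

lemma v_cont:
  assumes "\<tau> < T"
  shows "continuous_on (closure \<Omega> \<times> {0..\<tau>}) (\<lambda>(x, t). v x t)"
proof -
  have "continuous_on {-1<..<1} H"
    using H by (intro continuous_at_imp_continuous_on) (blast intro: DERIV_isCont)
  then have "continuous_on (closure \<Omega> \<times> {0..\<tau>}) (\<lambda>q. H ((\<lambda>(x, t). u x t) q))"
    by (rule continuous_on_compose2[OF _ u_cont[OF assms]]) (use u_range(1) assms in force)
  then show ?thesis by (simp add: v_def case_prod_beta)
qed

lemma v_evolution:
  assumes x: "x \<in> \<Omega>" and t: "0 \<le> t" "t < T"
  obtains p L where "has_lap (\<lambda>y. v y t) x p L"
    "(v x has_real_derivative L + source \<mu> k (u x t)) (at t within {0..})"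
proof -
  note ur = u_range(1)[OF closureI[OF x] t]
  note e = u_evolution[OF x t]
  define p where "p = grad (\<lambda>y. u y t) x"
  define L where "L = laplacian (\<lambda>y. u y t) x"
  define Y where "Y = recip_gap (u x t)"
  have "((\<lambda>r. exp (k * recip_gap r)) has_real_derivative k * Y\<^sup>2 * exp (k * Y)) (at (u x t))"
    unfolding Y_def using ur by (auto intro!: derivative_eq_intros)
  then have "has_lap (\<lambda>y. H (u y t)) x (exp (k * recip_gap (u x t)) *\<^sub>R p)
      ((k * Y\<^sup>2 * exp (k * Y)) * (norm p)\<^sup>2 + exp (k * recip_gap (u x t)) * L)" (is "has_lap _ _ _ ?L")
    unfolding p_def L_def
    by (intro has_lap_compose[OF e(1), of "{-1<..<1}"] H ur) auto
  moreover have "((\<lambda>t. H (u x t)) has_real_derivative exp (k * Y) * dt u x t) (at t within {0..})"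
    unfolding Y_def by (rule DERIV_chain2[OF H[OF ur] e(2)])
  moreover have "exp (k * Y) * dt u x t = ?L + source \<mu> k (u x t)"
  proof -
    have "dt u x t = L + \<mu> * Y\<^sup>2 * (1 + \<delta> * (norm p)\<^sup>2)" using e(3) by (simp add: L_def p_def Y_def)
    then show ?thesis by (simp add: source_def Y_def[symmetric] k_def algebra_simps)
  qed
  ultimately show ?thesis using that unfolding v_def [abs_def] by simp
qed

section \<open>Time difference quotients\<close>

text \<open>The function \<open>v\<^sub>t\<close> formally solves the linearized equation, but \<open>u\<^sub>t\<close> is only continuous in the open set \<open>\<Omega>\<close> and
  nothing is known about it near the lateral boundary. A difference quotient in time replaces it:
  this has all derivatives that \<open>v\<close> has and vanishes on the boundary. All bounds must therefore be
  uniform in the step \<open>h\<close>.\<close>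

definition quot :: "real \<Rightarrow> real ^ 'n \<Rightarrow> real \<Rightarrow> real" where
  "quot h x t = (v x (t + h) - v x t) / h"

lemma quot_cont:
  assumes "0 < h" "\<tau> + h < T"
  shows "continuous_on (closure \<Omega> \<times> {0..\<tau>}) (\<lambda>(x, t). quot h x t)"
proof -
  have "continuous_on (closure \<Omega> \<times> {0..\<tau>}) (\<lambda>q. (\<lambda>(x, t). v x t) (fst q, snd q + h))"
    by (rule continuous_on_compose2[OF v_cont[OF assms(2)]]) (use assms in \<open>auto intro!: continuous_intros\<close>)
  moreover have "continuous_on (closure \<Omega> \<times> {0..\<tau>}) (\<lambda>(x, t). v x t)"
    using assms by (intro v_cont) simp
  ultimately show ?thesis unfolding quot_def case_prod_beta
    using assms by (intro continuous_intros) auto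
qed

text \<open>Convexity of \<open>F\<close> bounds the difference quotient of \<open>F v\<close> from below by \<open>F' (v)\<close> times that of \<open>v\<close>, so the
  difference quotient is a supersolution of the linearized equation.\<close>

lemma quot_evolution:
  assumes x: "x \<in> \<Omega>" and t: "0 < t" and h: "0 < h" "t + h < T"
  obtains Wt p L where "(quot h x has_real_derivative Wt) (at t)" "has_lap (\<lambda>y. quot h y t) x p L"
    "source_slope \<mu> k (u x t) * quot h x t \<le> Wt - L"
proof -
  have t': "0 \<le> t" "t < T" "0 \<le> t + h" using t h by auto
  obtain p L where 1: "has_lap (\<lambda>y. v y t) x p L"
    "(v x has_real_derivative L + source \<mu> k (u x t)) (at t within {0..})"
    using v_evolution[OF x t'(1,2)] by blast
  obtain p' L' where 2: "has_lap (\<lambda>y. v y (t + h)) x p' L'"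
    "(v x has_real_derivative L' + source \<mu> k (u x (t + h))) (at (t + h) within {0..})"
    using v_evolution[OF x t'(3) h(2)] by blast
  have d2: "((\<lambda>t. v x (t + h)) has_real_derivative L' + source \<mu> k (u x (t + h))) (at t)"
    using DERIV_at_interior_time[OF 2(2)] t h by (simp add: DERIV_shift)
  have d1: "(v x has_real_derivative L + source \<mu> k (u x t)) (at t)"
    using DERIV_at_interior_time[OF 1(2)] t by simp
  have "has_lap (\<lambda>y. 1 / h * v y (t + h) + (- 1 / h) * v y t) x
      ((1 / h) *\<^sub>R p' + (- 1 / h) *\<^sub>R p) (1 / h * L' + (- 1 / h) * L)" (is "has_lap _ _ ?p ?L")
    by (rule has_lap_linear[OF 2(1) 1(1)])
  then have lap: "has_lap (\<lambda>y. quot h y t) x ?p ?L"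
    using h by (simp add: quot_def diff_divide_distrib)
  have der: "(quot h x has_real_derivative
      ((L' + source \<mu> k (u x (t + h))) - (L + source \<mu> k (u x t))) / h) (at t)" (is "(_ has_real_derivative ?W) _")
    unfolding quot_def [abs_def] by (intro DERIV_cdivide DERIV_diff d1 d2)
  have "source_slope \<mu> k (u x t) * (v x (t + h) - v x t) \<le> source \<mu> k (u x (t + h)) - source \<mu> k (u x t)"
    unfolding v_def using u_range(1)[OF closureI[OF x]] t' h
    by (intro source_convex[OF H \<mu> k]) auto
  then have "source_slope \<mu> k (u x t) * (v x (t + h) - v x t) / h \<le>
      (source \<mu> k (u x (t + h)) - source \<mu> k (u x t)) / h"
    using h by (intro divide_right_mono) auto
  moreover have "?W - ?L = (source \<mu> k (u x (t + h)) - source \<mu> k (u x t)) / h"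
    using h by (simp add: diff_divide_distrib add_divide_distrib)
  ultimately have "source_slope \<mu> k (u x t) * quot h x t \<le> ?W - ?L"
    by (simp add: quot_def)
  then show ?thesis using that der lap by blast
qed

lemma slope_bounded:
  assumes "\<tau> < T"
  obtains K where "\<And>x t. x \<in> \<Omega> \<Longrightarrow> 0 \<le> t \<Longrightarrow> t \<le> \<tau> \<Longrightarrow> source_slope \<mu> k (u x t) \<le> K"
proof (cases "\<Omega> = {} \<or> \<tau> < 0")
  case True then show ?thesis using that by fastforce
next
  case False
  then have "closure \<Omega> \<times> {0..\<tau>} \<noteq> {}" by auto
  moreover have "compact (closure \<Omega> \<times> {0..\<tau>})" using \<Omega> by (intro compact_Times) auto
  ultimately obtain q where q: "q \<in> closure \<Omega> \<times> {0..\<tau>}"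
    "\<And>r. r \<in> closure \<Omega> \<times> {0..\<tau>} \<Longrightarrow> (\<lambda>(x, t). u x t) r \<le> (\<lambda>(x, t). u x t) q"
    using continuous_attains_sup[OF _ _ u_cont[OF assms]] by metis
  show ?thesis
  proof (rule that)
    fix x t assume "x \<in> \<Omega>" "0 \<le> t" "t \<le> \<tau>"
    then show "source_slope \<mu> k (u x t) \<le> source_slope \<mu> k (u (fst q) (snd q))"
      using q(2)[of "(x, t)"] q(1) closureI u_less_1[of "fst q" "snd q"] assms
      by (intro source_slope_mono[OF \<mu> k]) (auto simp: case_prod_beta)
  qed
qed

lemma quot_bdry: "x \<in> frontier \<Omega> \<Longrightarrow> 0 \<le> t \<Longrightarrow> 0 < h \<Longrightarrow> t + h < T \<Longrightarrow> quot h x t = 0"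
  by (simp add: quot_def v_def u_bdry)

lemma quot_init:
  assumes "x \<in> closure \<Omega>" "0 < h" "h < T"
  shows "u x h / h \<le> quot h x 0"
proof -
  have "u x h \<le> H (u x h)" using u_range(2)[of x h] assms by (intro H_ge) auto
  moreover have "u x 0 = 0" using u_init assms by simp
  ultimately show ?thesis using assms by (simp add: quot_def v_def H_0 divide_right_mono)
qed

lemma quot_nonneg:
  assumes x: "x \<in> closure \<Omega>" and t: "0 \<le> t" and h: "0 < h" "t + h < T"
  shows "0 \<le> quot h x t"
proof -
  obtain K where K: "\<And>x s. x \<in> \<Omega> \<Longrightarrow> 0 \<le> s \<Longrightarrow> s \<le> t \<Longrightarrow> source_slope \<mu> k (u x s) \<le> K"
    using slope_bounded[of t] h by auto
  show ?thesis
  proof (rule parabolic_min_principle[OF \<Omega>(1,3) quot_cont[OF h] _ _ _ x t order_refl])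
    show "0 \<le> quot h y s" if "y \<in> frontier \<Omega>" "0 \<le> s" "s \<le> t" for y s
      using quot_bdry[of y s h] that h by simp
    show "0 \<le> quot h y 0" if "y \<in> \<Omega>" for y
      using quot_init[of y h] u_nonneg[of y h] closureI[OF that] t h
      by (smt (verit) divide_nonneg_pos)
    show "\<exists>Z Zt p L. (\<forall>y\<in>\<Omega>. \<forall>s\<in>{0..t}. quot h y s \<le> Z y s) \<and> Z y s = quot h y s \<and>
        (Z y has_real_derivative Zt) (at s) \<and> has_lap (\<lambda>y. Z y s) y p L \<and> K * quot h y s \<le> Zt - L"
      if ys: "y \<in> \<Omega>" "0 < s" "s \<le> t" "quot h y s < 0" for y s
    proof -
      obtain Wt p L where W: "(quot h y has_real_derivative Wt) (at s)" "has_lap (\<lambda>y. quot h y s) y p L"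
        "source_slope \<mu> k (u y s) * quot h y s \<le> Wt - L"
        using quot_evolution[OF ys(1,2) h(1)] ys(3) h(2) by (metis add_le_cancel_right order_le_less_trans)
      have "K * quot h y s \<le> source_slope \<mu> k (u y s) * quot h y s"
        using K[of y s] ys by (intro mult_right_mono_neg) auto
      then show ?thesis using W by (intro exI[of _ "quot h"] exI[of _ Wt] exI[of _ p] exI[of _ L]) auto
    qed
  qed
qed

text \<open>The source is at least \<open>\<mu>\<close>, so \<open>u\<close> stays above a multiple of \<open>t exp (- \<kappa> t)\<close> times a bump of radius \<open>\<rho>\<close>.
  The constant depends on \<open>\<rho>\<close> but not on the centre.\<close>

lemma u_initial_growth:
  assumes \<rho>: "0 < \<rho>"
  shows "\<exists>m>0. \<forall>x t. cball x \<rho> \<subseteq> \<Omega> \<and> 0 \<le> t \<and> t < T \<longrightarrow> m * t \<le> u x t"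
proof -
  obtain \<kappa> where \<kappa>: "0 < \<kappa>" and bump: "\<And>x0 x :: real ^ 'n. \<exists>p L.
      has_lap (\<lambda>y. (\<rho>\<^sup>2 - (norm (y - x0))\<^sup>2)\<^sup>2) x p L \<and> 0 \<le> \<kappa> * (\<rho>\<^sup>2 - (norm (x - x0))\<^sup>2)\<^sup>2 + L"
    using bump_almost_eigenfunction[OF \<rho>] by blast
  define a where "a = \<mu> / \<rho> ^ 4"
  have a: "0 < a" using \<mu> \<rho> by (simp add: a_def)
  have main: "\<mu> * exp (- \<kappa> * T) * t \<le> u x t" if x: "cball x \<rho> \<subseteq> \<Omega>" and t: "0 \<le> t" "t < T" for x t
  proof -
    define \<xi> where "\<xi> y = (\<rho>\<^sup>2 - (norm (y - x))\<^sup>2)\<^sup>2" for y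
    define z where "z y s = u y s - a * (s * exp (- \<kappa> * s)) * \<xi> y" for y s
    have sub: "closure (ball x \<rho>) \<subseteq> \<Omega>" using x \<rho> by simp
    have "0 \<le> z x t"
    proof (rule parabolic_min_principle[of "ball x \<rho>" t z _ x t])
      have "continuous_on (closure (ball x \<rho>) \<times> {0..t}) (\<lambda>(x, t). u x t)"
        using sub closureI by (intro continuous_on_subset[OF u_cont[OF t(2)]]) auto
      then show "continuous_on (closure (ball x \<rho>) \<times> {0..t}) (\<lambda>(x, t). z x t)"
        unfolding z_def \<xi>_def case_prod_beta by (intro continuous_intros)
      show "0 \<le> z y s" if "y \<in> frontier (ball x \<rho>)" "0 \<le> s" "s \<le> t" for y s
      proof -
        have y: "dist x y = \<rho>" using that \<rho> by simp
        then have "y \<in> closure \<Omega>" using x closureI by auto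
        moreover have "\<xi> y = 0" using y by (simp add: \<xi>_def dist_norm norm_minus_commute)
        ultimately show ?thesis using u_nonneg[of y s] that t by (simp add: z_def)
      qed
      show "0 \<le> z y 0" if "y \<in> ball x \<rho>" for y
      proof -
        have "y \<in> \<Omega>" using that x by auto
        then show ?thesis using u_nonneg[of y 0] closureI t by (simp add: z_def)
      qed
      show "\<exists>Z Zt p L. (\<forall>y\<in>ball x \<rho>. \<forall>s\<in>{0..t}. z y s \<le> Z y s) \<and> Z y s = z y s \<and>
          (Z y has_real_derivative Zt) (at s) \<and> has_lap (\<lambda>y. Z y s) y p L \<and> 0 * z y s \<le> Zt - L"
        if "y \<in> ball x \<rho>" "0 < s" "s \<le> t" "z y s < 0" for y s
      proof -
        have y: "y \<in> \<Omega>" and s: "0 \<le> s" "s < T" using that x t by auto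
        note e = u_evolution[OF y s]
        obtain p L where L: "has_lap \<xi> y p L" "0 \<le> \<kappa> * \<xi> y + L"
          using bump[of x y] unfolding \<xi>_def by blast
        have "has_lap (\<lambda>y. 1 * u y s + (- (a * (s * exp (- \<kappa> * s)))) * \<xi> y) y
            (1 *\<^sub>R grad (\<lambda>y. u y s) y + (- (a * (s * exp (- \<kappa> * s)))) *\<^sub>R p)
            (1 * laplacian (\<lambda>y. u y s) y + (- (a * (s * exp (- \<kappa> * s)))) * L)"
          by (rule has_lap_linear[OF e(1) L(1)])
        then have 1: "has_lap (\<lambda>y. z y s) y
            (1 *\<^sub>R grad (\<lambda>y. u y s) y + (- (a * (s * exp (- \<kappa> * s)))) *\<^sub>R p)
            (laplacian (\<lambda>y. u y s) y - a * (s * exp (- \<kappa> * s)) * L)"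
          by (simp add: z_def)
        have "(u y has_real_derivative dt u y s) (at s)"
          using e(2) that by (intro DERIV_at_interior_time)
        then have 2: "(z y has_real_derivative dt u y s - a * (exp (- \<kappa> * s) - \<kappa> * s * exp (- \<kappa> * s)) * \<xi> y) (at s)"
          unfolding z_def by (auto intro!: derivative_eq_intros simp: algebra_simps)
        have "\<rho>\<^sup>2 - (norm (y - x))\<^sup>2 \<le> \<rho>\<^sup>2" "0 \<le> \<rho>\<^sup>2 - (norm (y - x))\<^sup>2"
          using that \<rho> by (auto simp: dist_norm norm_minus_commute intro!: power_mono)
        then have "\<xi> y \<le> (\<rho>\<^sup>2)\<^sup>2" unfolding \<xi>_def by (rule power_mono)
        then have "a * (exp (- \<kappa> * s) * \<xi> y) \<le> a * (1 * (\<rho>\<^sup>2)\<^sup>2)"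
          using a \<kappa> s by (intro mult_left_mono mult_mono) (auto simp: \<xi>_def)
        also have "\<dots> = \<mu>" using \<rho> by (simp add: a_def power_mult flip: power_mult)
        also have "\<mu> = \<mu> * 1 * 1" by simp
        also have "\<dots> \<le> \<mu> * (recip_gap (u y s))\<^sup>2 * (1 + \<delta> * (norm (grad (\<lambda>y. u y s) y))\<^sup>2)"
          using \<mu> \<delta> recip_gap_ge_1[of "u y s"] u_range(2)[of y s] closureI[OF y] s
          by (intro mult_mono) (auto simp: one_le_power)
        also have "\<dots> = dt u y s - laplacian (\<lambda>y. u y s) y" using e(3) by simp
        finally have "a * (exp (- \<kappa> * s) * \<xi> y) \<le> dt u y s - laplacian (\<lambda>y. u y s) y" .
        moreover have "0 \<le> a * (s * exp (- \<kappa> * s)) * (\<kappa> * \<xi> y + L)"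
          using a s L(2) by simp
        ultimately have "0 * z y s \<le> dt u y s - a * (exp (- \<kappa> * s) - \<kappa> * s * exp (- \<kappa> * s)) * \<xi> y
            - (laplacian (\<lambda>y. u y s) y - a * (s * exp (- \<kappa> * s)) * L)"
          by (simp add: algebra_simps)
        then show ?thesis using 1 2 by (intro exI[of _ z] exI conjI) auto
      qed
    qed (use t \<rho> in auto)
    moreover have "\<xi> x = \<rho> ^ 4" by (simp add: \<xi>_def flip: power_mult)
    ultimately have "\<mu> * (t * exp (- \<kappa> * t)) \<le> u x t" using \<rho> by (simp add: z_def a_def)
    moreover have "\<mu> * exp (- \<kappa> * T) * t \<le> \<mu> * exp (- \<kappa> * t) * t"
      using \<mu> \<kappa> t by (intro mult_right_mono mult_left_mono) auto
    ultimately show ?thesis by (simp add: mult_ac)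
  qed
  show ?thesis
    using main \<mu> by (intro exI[of _ "\<mu> * exp (- \<kappa> * T)"]) auto
qed

text \<open>At time \<open>0\<close> the quotient is \<open>v x h / h\<close>, which \<open>u_initial_growth\<close> bounds below on the ball of radius \<open>\<rho>\<close>
  around \<open>x\<close> independently of \<open>h\<close>; a decaying bump on that ball carries the bound to later times.\<close>

lemma quot_interior_lower_bound:
  assumes \<rho>: "0 < \<rho>"
  shows "\<exists>m>0. \<forall>x t h. cball x (2 * \<rho>) \<subseteq> \<Omega> \<and> 0 \<le> t \<and> 0 < h \<and> t + h < T \<longrightarrow> m \<le> quot h x t"
proof -
  obtain \<kappa> where \<kappa>: "0 < \<kappa>" and bump: "\<And>x0 x :: real ^ 'n. \<exists>p L.
      has_lap (\<lambda>y. (\<rho>\<^sup>2 - (norm (y - x0))\<^sup>2)\<^sup>2) x p L \<and> 0 \<le> \<kappa> * (\<rho>\<^sup>2 - (norm (x - x0))\<^sup>2)\<^sup>2 + L"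
    using bump_almost_eigenfunction[OF \<rho>] by blast
  obtain m where m: "0 < m" and um: "\<And>x t. cball x \<rho> \<subseteq> \<Omega> \<Longrightarrow> 0 \<le> t \<Longrightarrow> t < T \<Longrightarrow> m * t \<le> u x t"
    using u_initial_growth[OF \<rho>] by blast
  define a where "a = m / \<rho> ^ 4"
  have a: "0 < a" using m \<rho> by (simp add: a_def)
  have main: "m * exp (- \<kappa> * T) \<le> quot h x t"
    if x: "cball x (2 * \<rho>) \<subseteq> \<Omega>" and t: "0 \<le> t" and h: "0 < h" "t + h < T" for x t h
  proof -
    define \<xi> where "\<xi> y = (\<rho>\<^sup>2 - (norm (y - x))\<^sup>2)\<^sup>2" for y
    define z where "z y s = quot h y s - a * exp (- \<kappa> * s) * \<xi> y" for y s
    have sub: "cball y \<rho> \<subseteq> \<Omega>" if "y \<in> cball x \<rho>" for y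
    proof
      fix q assume "q \<in> cball y \<rho>"
      then have "dist x q \<le> 2 * \<rho>" using that dist_triangle[of x q y] by (simp add: dist_commute)
      then show "q \<in> \<Omega>" using x by auto
    qed
    then have sub': "y \<in> \<Omega>" if "y \<in> cball x \<rho>" for y
      using that \<rho> by (meson centre_in_cball less_imp_le subsetD)
    have "0 \<le> z x t"
    proof (rule parabolic_min_principle[of "ball x \<rho>" t z _ x t])
      have "continuous_on (closure (ball x \<rho>) \<times> {0..t}) (\<lambda>(x, t). quot h x t)"
        using sub' closureI \<rho> by (intro continuous_on_subset[OF quot_cont[OF h]]) auto
      then show "continuous_on (closure (ball x \<rho>) \<times> {0..t}) (\<lambda>(x, t). z x t)"
        unfolding z_def \<xi>_def case_prod_beta by (intro continuous_intros)
      show "0 \<le> z y s" if "y \<in> frontier (ball x \<rho>)" "0 \<le> s" "s \<le> t" for y s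
      proof -
        have y: "dist x y = \<rho>" using that \<rho> by simp
        then have "y \<in> closure \<Omega>" using sub'[of y] closureI by auto
        moreover have "\<xi> y = 0" using y by (simp add: \<xi>_def dist_norm norm_minus_commute)
        ultimately show ?thesis using quot_nonneg[of y s h] that t h by (simp add: z_def)
      qed
      have \<xi>_le: "\<xi> y \<le> \<rho> ^ 4" if "y \<in> ball x \<rho>" for y
      proof -
        have "\<rho>\<^sup>2 - (norm (y - x))\<^sup>2 \<le> \<rho>\<^sup>2" "0 \<le> \<rho>\<^sup>2 - (norm (y - x))\<^sup>2"
          using that \<rho> by (auto simp: dist_norm norm_minus_commute intro!: power_mono)
        then have "\<xi> y \<le> (\<rho>\<^sup>2)\<^sup>2" unfolding \<xi>_def by (rule power_mono)
        then show ?thesis by (simp flip: power_mult)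
      qed
      show "0 \<le> z y 0" if "y \<in> ball x \<rho>" for y
      proof -
        have y: "y \<in> cball x \<rho>" using that by simp
        have "a * \<xi> y \<le> a * \<rho> ^ 4" using \<xi>_le[OF that] a by (intro mult_left_mono) auto
        also have "\<dots> = m" using \<rho> by (simp add: a_def)
        also have "m \<le> u y h / h" using um[OF sub[OF y], of h] t h by (simp add: field_simps)
        also have "\<dots> \<le> quot h y 0" using closureI[OF sub'[OF y]] t h by (intro quot_init) auto
        finally show ?thesis by (simp add: z_def)
      qed
      show "\<exists>Z Zt p L. (\<forall>y\<in>ball x \<rho>. \<forall>s\<in>{0..t}. z y s \<le> Z y s) \<and> Z y s = z y s \<and>
          (Z y has_real_derivative Zt) (at s) \<and> has_lap (\<lambda>y. Z y s) y p L \<and> 0 * z y s \<le> Zt - L"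
        if "y \<in> ball x \<rho>" "0 < s" "s \<le> t" "z y s < 0" for y s
      proof -
        have y: "y \<in> \<Omega>" and s: "0 \<le> s" "s + h < T" and s0: "0 < s" using that sub' t h by auto
        obtain Wt q LW where W: "(quot h y has_real_derivative Wt) (at s)" "has_lap (\<lambda>y. quot h y s) y q LW"
          "source_slope \<mu> k (u y s) * quot h y s \<le> Wt - LW"
          using quot_evolution[OF y s0 h(1) s(2)] by blast
        obtain p L where L: "has_lap \<xi> y p L" "0 \<le> \<kappa> * \<xi> y + L"
          using bump[of x y] unfolding \<xi>_def by blast
        have "has_lap (\<lambda>y. 1 * quot h y s + (- (a * exp (- \<kappa> * s))) * \<xi> y) y
            (1 *\<^sub>R q + (- (a * exp (- \<kappa> * s))) *\<^sub>R p) (1 * LW + (- (a * exp (- \<kappa> * s))) * L)"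
          by (rule has_lap_linear[OF W(2) L(1)])
        then have 1: "has_lap (\<lambda>y. z y s) y
            (1 *\<^sub>R q + (- (a * exp (- \<kappa> * s))) *\<^sub>R p) (LW - a * exp (- \<kappa> * s) * L)"
          by (simp add: z_def)
        have 2: "(z y has_real_derivative Wt + a * \<kappa> * exp (- \<kappa> * s) * \<xi> y) (at s)"
          unfolding z_def using W(1) by (auto intro!: derivative_eq_intros simp: algebra_simps)
        have "0 \<le> source_slope \<mu> k (u y s) * quot h y s"
          using source_slope_nonneg[OF \<mu> k] quot_nonneg[of y s h] u_less_1[of y s] closureI[OF y] s h by simp
        moreover have "0 \<le> a * exp (- \<kappa> * s) * (\<kappa> * \<xi> y + L)" using a L(2) by simp
        ultimately have "0 * z y s \<le> Wt + a * \<kappa> * exp (- \<kappa> * s) * \<xi> y - (LW - a * exp (- \<kappa> * s) * L)"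
          using W(3) by (simp add: algebra_simps)
        then show ?thesis using 1 2 by (intro exI[of _ z] exI conjI) auto
      qed
    qed (use t \<rho> in auto)
    moreover have "\<xi> x = \<rho> ^ 4" by (simp add: \<xi>_def flip: power_mult)
    ultimately have "m * exp (- \<kappa> * t) \<le> quot h x t" using \<rho> by (simp add: z_def a_def)
    moreover have "m * exp (- \<kappa> * T) \<le> m * exp (- \<kappa> * t)"
      using m \<kappa> t h by (intro mult_left_mono) auto
    ultimately show ?thesis by simp
  qed
  show ?thesis
    using main m by (intro exI[of _ "m * exp (- \<kappa> * T)"]) auto
qed

section \<open>The lower bound for the time derivative\<close>

lemma barrier_props:
  assumes "x \<in> \<Omega>"
  shows "0 \<le> barrier \<Omega> x" "barrier \<Omega> x \<le> 2 * (diameter \<Omega>)\<^sup>2"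
    "barrier \<Omega> x \<le> 2 * diameter \<Omega> * infdist x (- \<Omega>)"
proof -
  have d: "0 \<le> infdist x (- \<Omega>)" "infdist x (- \<Omega>) \<le> diameter \<Omega>"
    using infdist_compl_le[OF \<Omega>(1,3) assms] by (auto simp: infdist_nonneg)
  then show "0 \<le> barrier \<Omega> x" by (simp add: barrier_def)
  have "infdist x (- \<Omega>) * (3 * diameter \<Omega> - infdist x (- \<Omega>)) \<le> infdist x (- \<Omega>) * (4 * diameter \<Omega>)"
    using d by (intro mult_left_mono) auto
  then show le: "barrier \<Omega> x \<le> 2 * diameter \<Omega> * infdist x (- \<Omega>)"
    by (simp add: barrier_def mult_ac)
  also have "\<dots> \<le> 2 * diameter \<Omega> * diameter \<Omega>" using d by (intro mult_left_mono) auto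
  finally show "barrier \<Omega> x \<le> 2 * (diameter \<Omega>)\<^sup>2" by (simp add: power2_eq_square)
qed

text \<open>The comparison function is \<open>\<epsilon> (growth (u) - B \<zeta>)\<close> with \<open>\<zeta>\<close> the barrier. It is at most \<open>0\<close> on the
  parabolic boundary, and where it is positive it must be a subsolution of the linearized equation. Three
  regions arise. Near the boundary (\<open>B \<zeta> \<le> 1\<close>) the term \<open>B\<close> coming from \<open>- \<Delta>\<zeta>\<close> pays for the values \<open>u \<le> r1\<close>, and
  \<open>growth_subsolution\<close> with the constant \<open>1\<close> covers the larger ones. Far from the boundary and for \<open>u > r2\<close>,
  \<open>growth_subsolution\<close> with an upper bound \<open>C\<close> of \<open>B \<zeta>\<close> applies. In the remaining region, far from the boundary
  and with \<open>u \<le> r2\<close>, a small \<open>\<epsilon>\<close> keeps the comparison function below the interior lower bound of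
  the quotient. The conclusion is uniform up to the boundary since \<open>\<zeta>\<close> is bounded.\<close>

lemma quot_ge_growth:
  "\<exists>\<epsilon>>0. \<exists>C. \<forall>x\<in>\<Omega>. \<forall>t\<ge>0. \<forall>h>0. t + h < T \<longrightarrow> \<epsilon> * (growth k (u x t) - C) \<le> quot h x t"
proof -
  define \<Gamma> where "\<Gamma> r = \<mu> * (recip_gap r)\<^sup>2 * growth' k r" for r
  have \<Gamma>_mono: "\<Gamma> r \<le> \<Gamma> s" if "0 \<le> r" "r \<le> s" "s < 1" for r s
  proof -
    have "0 < recip_gap r" "recip_gap r \<le> recip_gap s"
      using that by (auto intro!: recip_gap_pos recip_gap_mono)
    then show ?thesis unfolding \<Gamma>_def growth'_def using \<mu> k
      by (intro mult_mono add_mono power_mono) auto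
  qed
  obtain r1 where r1: "0 \<le> r1" "r1 < 1"
    "\<And>r. r1 \<le> r \<Longrightarrow> r < 1 \<Longrightarrow> \<Gamma> r \<le> source_slope \<mu> k r * (growth k r - 1)"
    using growth_subsolution[OF \<mu> k, of 1] unfolding \<Gamma>_def by blast
  define B where "B = max 1 (\<Gamma> r1)"
  have B: "1 \<le> B" "\<Gamma> r1 \<le> B" by (auto simp: B_def)
  define C where "C = B * (2 * (diameter \<Omega>)\<^sup>2)"
  obtain r2 where r2: "0 \<le> r2" "r2 < 1"
    "\<And>r. r2 \<le> r \<Longrightarrow> r < 1 \<Longrightarrow> \<Gamma> r \<le> source_slope \<mu> k r * (growth k r - C)"
    using growth_subsolution[OF \<mu> k, of C] unfolding \<Gamma>_def by blast
  \<comment> \<open>Points with \<open>B \<zeta> > 1\<close> are farther than \<open>2 \<rho>\<close> from the complement of \<open>\<Omega>\<close>; the summand 1 only avoids a division by zero.\<close>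
  define \<rho> where "\<rho> = 1 / (4 * B * (diameter \<Omega> + 1))"
  have diam: "0 \<le> diameter \<Omega>" using \<Omega>(3) by (rule diameter_ge_0)
  then have \<rho>: "0 < \<rho>" using B by (simp add: \<rho>_def)
  obtain m where m: "0 < m" and qm: "\<And>x t h. cball x (2 * \<rho>) \<subseteq> \<Omega> \<Longrightarrow> 0 \<le> t \<Longrightarrow> 0 < h \<Longrightarrow> t + h < T \<Longrightarrow> m \<le> quot h x t"
    using quot_interior_lower_bound[OF \<rho>] by blast
  define \<epsilon> where "\<epsilon> = m / (growth k r2 + 1)"
  have g2: "0 \<le> growth k r2" using growth_mono[OF k r2(1,2)] by (simp add: growth_0)
  then have \<epsilon>: "0 < \<epsilon>" using m by (simp add: \<epsilon>_def)
  have "\<epsilon> * growth k r2 \<le> m * 1" unfolding \<epsilon>_def using m g2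
    by (simp add: field_simps)
  then have \<epsilon>m: "\<epsilon> * growth k r2 \<le> m" by simp
  have interior: "cball x (2 * \<rho>) \<subseteq> \<Omega>" if x: "x \<in> \<Omega>" and far: "1 < B * barrier \<Omega> x" for x
  proof
    define d where "d = infdist x (- \<Omega>)"
    have "d \<ge> 0" by (simp add: d_def infdist_nonneg)
    have "B * barrier \<Omega> x \<le> B * (2 * diameter \<Omega> * d)"
      unfolding d_def using B by (intro mult_left_mono barrier_props x) auto
    with far have "1 < B * (2 * diameter \<Omega> * d)" by linarith
    also have "\<dots> \<le> 2 * B * (diameter \<Omega> + 1) * d" using B \<open>d \<ge> 0\<close> by (simp add: algebra_simps)
    also have "\<dots> = d / (2 * \<rho>)" by (simp add: \<rho>_def)
    finally have "2 * \<rho> < d" using \<rho> by (simp add: less_divide_eq)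
    moreover fix y assume "y \<in> cball x (2 * \<rho>)"
    ultimately have "dist x y < infdist x (- \<Omega>)" by (simp add: d_def)
    then show "y \<in> \<Omega>" using infdist_le[of y "- \<Omega>" x] by fastforce
  qed
  have main: "\<epsilon> * (growth k (u x t) - C) \<le> quot h x t"
    if x: "x \<in> \<Omega>" and t: "0 \<le> t" and h: "0 < h" "t + h < T" for x t h
  proof -
    define z where "z y s = quot h y s + \<epsilon> * (B * barrier \<Omega> y - growth k (u y s))" for y s
    obtain K where K: "\<And>x s. x \<in> \<Omega> \<Longrightarrow> 0 \<le> s \<Longrightarrow> s \<le> t \<Longrightarrow> source_slope \<mu> k (u x s) \<le> K"
      using slope_bounded[of t] h by auto
    have "0 \<le> z x t"
    proof (rule parabolic_min_principle[OF \<Omega>(1,3), of t z _ x t])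
      have "continuous_on {-1<..<1} (growth k)"
        using DERIV_growth by (intro continuous_at_imp_continuous_on) (force intro: DERIV_isCont)
      then have "continuous_on (closure \<Omega> \<times> {0..t}) (\<lambda>q. growth k ((\<lambda>(x, t). u x t) q))"
        by (rule continuous_on_compose2[OF _ u_cont]) (use u_range(1) h in force)+
      then show "continuous_on (closure \<Omega> \<times> {0..t}) (\<lambda>(x, t). z x t)"
        unfolding z_def barrier_def case_prod_beta using quot_cont[OF h]
        by (intro continuous_intros) (auto simp: case_prod_beta)
      show "0 \<le> z y s" if "y \<in> frontier \<Omega>" "0 \<le> s" "s \<le> t" for y s
      proof -
        have "y \<in> - \<Omega>" using that \<Omega>(1) by (auto simp: frontier_def interior_open)
        then have "barrier \<Omega> y = 0" by (simp add: barrier_def)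
        then show ?thesis using quot_bdry[of y s h] u_bdry[of y s] that h by (simp add: z_def growth_0)
      qed
      show "0 \<le> z y 0" if y: "y \<in> \<Omega>" for y
        using quot_nonneg[of y 0 h] u_init[of y] closureI[OF y] barrier_props(1)[OF y] \<epsilon> B t h
        by (simp add: z_def growth_0)
      show "\<exists>Z Zt p L. (\<forall>y\<in>\<Omega>. \<forall>s\<in>{0..t}. z y s \<le> Z y s) \<and> Z y s = z y s \<and>
          (Z y has_real_derivative Zt) (at s) \<and> has_lap (\<lambda>y. Z y s) y p L \<and> K * z y s \<le> Zt - L"
        if y: "y \<in> \<Omega>" and s: "0 < s" "s \<le> t" and neg: "z y s < 0" for y s
      proof -
        have s': "0 \<le> s" "s < T" "s + h < T" using s h by auto
        note e = u_evolution[OF y s'(1,2)]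
        define r where "r = u y s"
        have r: "0 \<le> r" "r < 1" using u_range(2)[OF closureI[OF y] s'(1,2)] by (auto simp: r_def)
        define c where "c = source_slope \<mu> k r"
        have c: "0 \<le> c" "c \<le> K" using source_slope_nonneg[OF \<mu> k r(2)] K[OF y s'(1) s(2)]
          by (auto simp: c_def r_def)
        have q0: "0 \<le> quot h y s" using quot_nonneg[OF closureI[OF y] s'(1) h(1) s'(3)] .
        obtain Wt q LW where W: "(quot h y has_real_derivative Wt) (at s)" "has_lap (\<lambda>y. quot h y s) y q LW"
          "c * quot h y s \<le> Wt - LW"
          using quot_evolution[OF y s(1) h(1) s'(3)] unfolding c_def r_def by blast
        obtain \<zeta> p\<zeta> where \<zeta>: "\<And>y. y \<in> \<Omega> \<Longrightarrow> barrier \<Omega> y \<le> \<zeta> y" "\<zeta> y = barrier \<Omega> y" "has_lap \<zeta> y p\<zeta> (- 1)"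
          using barrier_touched[OF \<Omega> y] by blast
        define p where "p = grad (\<lambda>y. u y s) y"
        define L where "L = laplacian (\<lambda>y. u y s) y"
        have gl: "has_lap (\<lambda>y. growth k (u y s)) y (growth' k r *\<^sub>R p)
            (growth'' k r * (norm p)\<^sup>2 + growth' k r * L)"
          unfolding r_def p_def L_def
          by (rule has_lap_compose[OF e(1), of "{..<1}"]) (use r in \<open>auto simp: r_def intro!: DERIV_growth DERIV_growth'\<close>)
        \<comment> \<open>Replacing the barrier by the smooth \<open>\<zeta>\<close> above it gives a function that touches \<open>z\<close> from above.\<close>
        define Z where "Z y s = 1 * quot h y s + \<epsilon> * (B * \<zeta> y + (- 1) * growth k (u y s))" for y s
        have lap: "has_lap (\<lambda>y. Z y s) y (1 *\<^sub>R q + \<epsilon> *\<^sub>R (B *\<^sub>R p\<zeta> + (- 1) *\<^sub>R (growth' k r *\<^sub>R p)))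
            (1 * LW + \<epsilon> * (B * (- 1) + (- 1) * (growth'' k r * (norm p)\<^sup>2 + growth' k r * L)))"
          unfolding Z_def by (intro has_lap_linear W(2) \<zeta>(3) gl)
        have "(u y has_real_derivative dt u y s) (at s)"
          using e(2) s by (intro DERIV_at_interior_time)
        then have "((\<lambda>s. growth k (u y s)) has_real_derivative growth' k r * dt u y s) (at s)"
          unfolding r_def using r by (intro DERIV_chain2[OF DERIV_growth]) (auto simp: r_def)
        then have der: "(Z y has_real_derivative Wt - \<epsilon> * (growth' k r * dt u y s)) (at s)"
          unfolding Z_def using W(1) by (auto intro!: derivative_eq_intros)
        have Zt: "dt u y s = L + \<mu> * (recip_gap r)\<^sup>2 * (1 + \<delta> * (norm p)\<^sup>2)"
          using e(3) by (simp add: L_def p_def r_def)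
        have "k * (recip_gap r)\<^sup>2 * growth' k r * (norm p)\<^sup>2 \<le> growth'' k r * (norm p)\<^sup>2"
          using growth''_ge[OF k r(2)] by (intro mult_right_mono) auto
        then have "growth' k r * dt u y s - (growth'' k r * (norm p)\<^sup>2 + growth' k r * L) \<le> \<Gamma> r"
          unfolding Zt \<Gamma>_def k_def by (simp add: algebra_simps)
        then have "\<epsilon> * (growth' k r * dt u y s - (growth'' k r * (norm p)\<^sup>2 + growth' k r * L)) \<le> \<epsilon> * \<Gamma> r"
          using \<epsilon> by (intro mult_left_mono) auto
        have "\<epsilon> * 0 < \<epsilon> * (growth k r - B * barrier \<Omega> y)"
          using neg q0 by (simp add: z_def r_def algebra_simps)
        then have gpos: "B * barrier \<Omega> y < growth k r" using \<epsilon> by (simp add: zero_less_mult_iff)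
        have Bb: "0 \<le> B * barrier \<Omega> y" using barrier_props(1)[OF y] B by simp
        have key: "\<Gamma> r - B \<le> c * (growth k r - B * barrier \<Omega> y)"
        proof (cases "B * barrier \<Omega> y \<le> 1")
          case near: True
          show ?thesis
          proof (cases "r \<le> r1")
            case True
            then have "\<Gamma> r - B \<le> 0" using \<Gamma>_mono[of r r1] r r1 B by simp
            also have "0 \<le> c * (growth k r - B * barrier \<Omega> y)" using c gpos by simp
            finally show ?thesis .
          next
            case False
            then have "\<Gamma> r \<le> c * (growth k r - 1)" using r1(3)[of r] r by (simp add: c_def)
            also have "\<dots> \<le> c * (growth k r - B * barrier \<Omega> y)" using c near by (intro mult_left_mono) auto
            finally show ?thesis using B by simp
          qed
        next
          case far: False
          have "\<not> r \<le> r2"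
          proof
            assume "r \<le> r2"
            have "\<epsilon> * (growth k r - B * barrier \<Omega> y) \<le> \<epsilon> * growth k r2"
              using growth_mono[OF k \<open>r \<le> r2\<close> r2(2)] Bb \<epsilon> by (intro mult_left_mono) auto
            also have "\<dots> \<le> m" by (rule \<epsilon>m)
            also have "\<dots> \<le> quot h y s" using interior[OF y] far qm s' h by simp
            finally show False using neg by (simp add: z_def r_def algebra_simps)
          qed
          then have "\<Gamma> r \<le> c * (growth k r - C)" using r2(3)[of r] r by (simp add: c_def)
          also have "\<dots> \<le> c * (growth k r - B * barrier \<Omega> y)"
            using c barrier_props(2)[OF y] B unfolding C_def by (intro mult_left_mono) auto
          finally show ?thesis using B by simp
        qed
        have "K * z y s \<le> c * z y s" using c neg by (intro mult_right_mono_neg) auto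
        also have "\<dots> = c * quot h y s - \<epsilon> * (c * (growth k r - B * barrier \<Omega> y))"
          by (simp add: z_def r_def algebra_simps)
        also have "\<dots> \<le> (Wt - LW) - \<epsilon> * (\<Gamma> r - B)"
          using W(3) mult_left_mono[OF key less_imp_le[OF \<epsilon>]] by linarith
        also have "\<dots> \<le> Wt - \<epsilon> * (growth' k r * dt u y s) - (1 * LW + \<epsilon> * (B * (- 1) +
            (- 1) * (growth'' k r * (norm p)\<^sup>2 + growth' k r * L)))"
          using \<open>\<epsilon> * (growth' k r * dt u y s - (growth'' k r * (norm p)\<^sup>2 + growth' k r * L)) \<le> \<epsilon> * \<Gamma> r\<close>
          by (simp add: algebra_simps)
        finally have "K * z y s \<le> \<dots>" .
        moreover have "z y' s' \<le> Z y' s'" if "y' \<in> \<Omega>" for y' s'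
          using \<zeta>(1)[OF that] \<epsilon> B by (simp add: z_def Z_def)
        moreover have "Z y s = z y s" by (simp add: z_def Z_def \<zeta>(2))
        ultimately show ?thesis using der lap by blast
      qed
    qed (use x t closureI in auto)
    then have "\<epsilon> * (growth k (u x t) - B * barrier \<Omega> x) \<le> quot h x t"
      by (simp add: z_def algebra_simps)
    moreover have "\<epsilon> * (growth k (u x t) - C) \<le> \<epsilon> * (growth k (u x t) - B * barrier \<Omega> x)"
      using \<epsilon> B barrier_props(2)[OF x] unfolding C_def by (intro mult_left_mono) auto
    ultimately show ?thesis by simp
  qed
  then show ?thesis using \<epsilon> by blast
qed

lemma quot_tendsto:
  assumes x: "x \<in> \<Omega>" and t: "0 \<le> t" "t < T"
  shows "((\<lambda>s. quot (s - t) x t) \<longlongrightarrow> exp (k * recip_gap (u x t)) * dt u x t) (at_right t)"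
proof -
  have "(v x has_real_derivative exp (k * recip_gap (u x t)) * dt u x t) (at t within {0..})"
    unfolding v_def [abs_def]
    by (rule DERIV_chain2[OF H[OF u_range(1)[OF closureI[OF x] t]] u_evolution(2)[OF x t]])
  then have "(v x has_real_derivative exp (k * recip_gap (u x t)) * dt u x t) (at_right t)"
    by (rule DERIV_subset) (use t in auto)
  then show ?thesis by (simp add: has_field_derivative_iff quot_def)
qed

text \<open>Letting \<open>h \<rightarrow> 0\<close> in \<open>quot_ge_growth\<close> gives \<open>exp (k Y) u\<^sub>t \<ge> \<epsilon> (growth (u) - C)\<close> with \<open>Y = 1 / (1 - u)\<close>. Once
  \<open>Y \<ge> 2 exp k + C\<close>, the term \<open>Y exp (k Y)\<close> of \<open>growth\<close> compensates the constants.\<close>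

lemma dt_lower_bound:
  "\<exists>\<epsilon>>0. \<exists>r0<1. \<forall>x\<in>\<Omega>. \<forall>t. 0 \<le> t \<and> t < T \<and> r0 \<le> u x t \<longrightarrow> \<epsilon> * (recip_gap (u x t))\<^sup>2 \<le> dt u x t"
proof -
  obtain \<epsilon> C where \<epsilon>: "0 < \<epsilon>" and q: "\<And>x t h. x \<in> \<Omega> \<Longrightarrow> 0 \<le> t \<Longrightarrow> 0 < h \<Longrightarrow> t + h < T \<Longrightarrow>
      \<epsilon> * (growth k (u x t) - C) \<le> quot h x t"
    using quot_ge_growth by blast
  define Y0 where "Y0 = max 1 (2 * exp k + C)"
  have Y0: "1 \<le> Y0" "2 * exp k + C \<le> Y0" by (auto simp: Y0_def)
  have "\<epsilon> * (recip_gap (u x t))\<^sup>2 \<le> dt u x t"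
    if x: "x \<in> \<Omega>" and t: "0 \<le> t" "t < T" and r: "1 - 1 / Y0 \<le> u x t" for x t
  proof -
    define Y where "Y = recip_gap (u x t)"
    have lim: "((\<lambda>s. quot (s - t) x t) \<longlongrightarrow> exp (k * Y) * dt u x t) (at_right t)"
      using quot_tendsto[OF x t] by (simp add: Y_def)
    have "\<forall>\<^sub>F s in at_right t. \<epsilon> * (growth k (u x t) - C) \<le> quot (s - t) x t"
      using eventually_at_right_real[OF t(2)] by eventually_elim (rule q, use x t in auto)
    from tendsto_lowerbound[OF lim this]
    have le: "\<epsilon> * (growth k (u x t) - C) \<le> exp (k * Y) * dt u x t" by simp
    have "Y0 = recip_gap (1 - 1 / Y0)" using Y0 by (simp add: recip_gap_def)
    also have "\<dots> \<le> Y" unfolding Y_def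
      using r u_less_1[OF closureI[OF x] t] by (intro recip_gap_mono) auto
    finally have Y: "1 \<le> Y" "2 * exp k + C \<le> Y" using Y0 by auto
    have "1 \<le> exp (k * Y)" using Y k by simp
    from mult_right_mono[OF this, of Y] have "Y \<le> exp (k * Y) * Y" using Y by simp
    then have "exp (k * Y) * Y\<^sup>2 \<le> growth k (u x t) - C"
      using Y(2) unfolding growth_def Y_def[symmetric] distrib_left by linarith
    then have "\<epsilon> * (exp (k * Y) * Y\<^sup>2) \<le> \<epsilon> * (growth k (u x t) - C)"
      using \<epsilon> by (intro mult_left_mono) auto
    then have "exp (k * Y) * (\<epsilon> * Y\<^sup>2) \<le> exp (k * Y) * dt u x t"
      using le unfolding mult.left_commute[of "exp (k * Y)" \<epsilon>] by linarith
    then have "\<epsilon> * Y\<^sup>2 \<le> dt u x t" by (rule mult_left_le_imp_le) simp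
    then show ?thesis by (simp add: Y_def)
  qed
  then show ?thesis using \<epsilon> Y0 by (intro exI[of _ \<epsilon>] conjI exI[of _ "1 - 1 / Y0"]) auto
qed

section \<open>Integration in time\<close>

lemma u_mono:
  assumes x: "x \<in> \<Omega>" and t: "0 \<le> t" "t \<le> s" "s < T"
  shows "u x t \<le> u x s"
proof (rule ccontr)
  assume "\<not> u x t \<le> u x s"
  then have "t \<noteq> s" "v x s < v x t"
    using u_range(1)[OF closureI[OF x]] t by (auto simp: v_def intro!: H_mono)
  moreover have "0 \<le> quot (s - t) x t"
    using t \<open>t \<noteq> s\<close> by (intro quot_nonneg closureI x) auto
  ultimately show False using t by (auto simp: quot_def zero_le_divide_iff)
qed

text \<open>The bound \<open>u\<^sub>t \<ge> \<epsilon> / (1 - u)\<^sup>2\<close> says that \<open>(1 - u)\<^sup>3\<close> decreases at a rate of at least \<open>3 \<epsilon>\<close>. By monotonicity it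
  remains available once \<open>u \<ge> r0\<close>, and \<open>(1 - u)\<^sup>3\<close> stays positive until \<open>T\<close>. While \<open>u < r0\<close>, the gap is bounded
  below by a constant.\<close>

lemma gap_lower_bound:
  "\<exists>M>0. \<forall>x\<in>\<Omega>. \<forall>t\<in>{0..<T}. M * (T - t) powr (1 / 3) \<le> 1 - u x t"
proof (cases "0 < T")
  case False
  then show ?thesis by (intro exI[of _ 1]) auto
next
  case T: True
  obtain \<epsilon> r0 where \<epsilon>: "0 < \<epsilon>" and r0: "r0 < 1"
    and low: "\<And>x t. x \<in> \<Omega> \<Longrightarrow> 0 \<le> t \<Longrightarrow> t < T \<Longrightarrow> r0 \<le> u x t \<Longrightarrow> \<epsilon> * (recip_gap (u x t))\<^sup>2 \<le> dt u x t"
    using dt_lower_bound by blast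
  \<comment> \<open>The two entries serve the cases \<open>u \<ge> r0\<close> and \<open>u < r0\<close>.\<close>
  define A where "A = min (3 * \<epsilon>) ((1 - r0) ^ 3 / T)"
  have A: "0 < A" "A \<le> 3 * \<epsilon>" "A \<le> (1 - r0) ^ 3 / T" using \<epsilon> r0 T by (auto simp: A_def)
  have cube: "A * (T - t) \<le> (1 - u x t) ^ 3" if x: "x \<in> \<Omega>" and t: "0 \<le> t" "t < T" for x t
  proof (cases "r0 \<le> u x t")
    case False
    have "A * (T - t) \<le> (1 - r0) ^ 3 / T * T" using A t r0 T by (intro mult_mono) auto
    also have "\<dots> = (1 - r0) ^ 3" using T by simp
    also have "\<dots> \<le> (1 - u x t) ^ 3" using False r0 by (intro power_mono) auto
    finally show ?thesis .
  next
    case True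
    have step: "3 * \<epsilon> * (s - t) \<le> (1 - u x t) ^ 3" if s: "t < s" "s < T" for s
    proof -
      define \<psi> where "\<psi> q = (1 - u x q) ^ 3 + 3 * \<epsilon> * q" for q
      have cont: "continuous_on {t..s} (u x)"
      proof -
        have "continuous_on {t..s} (\<lambda>q. (\<lambda>(x, t). u x t) (x, q))"
          by (rule continuous_on_compose2[OF u_cont[OF s(2)]])
            (use t s closureI[OF x] in \<open>auto intro!: continuous_intros\<close>)
        then show ?thesis by simp
      qed
      have "\<psi> s \<le> \<psi> t"
      proof (rule DERIV_nonpos_imp_decreasing_open[of t s \<psi>])
        show "t \<le> s" using s by simp
        show "continuous_on {t..s} \<psi>" unfolding \<psi>_def by (intro continuous_intros cont)
        fix q assume q: "t < q" "q < s"
        have q': "0 \<le> q" "q < T" using q t s by auto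
        have "(u x has_real_derivative dt u x q) (at q)"
          using u_evolution(2)[OF x q'] q t by (intro DERIV_at_interior_time) auto
        then have "(\<psi> has_real_derivative - 3 * (1 - u x q)\<^sup>2 * dt u x q + 3 * \<epsilon>) (at q)"
          unfolding \<psi>_def by (auto intro!: derivative_eq_intros)
        moreover have "u x q < 1" using u_less_1[OF closureI[OF x] q'] .
        then have "(1 - u x q)\<^sup>2 * (\<epsilon> * (recip_gap (u x q))\<^sup>2) = \<epsilon>"
          by (simp add: recip_gap_def power_divide)
        moreover have "(1 - u x q)\<^sup>2 * (\<epsilon> * (recip_gap (u x q))\<^sup>2) \<le> (1 - u x q)\<^sup>2 * dt u x q"
          using low[OF x q'] u_mono[OF x t(1) _ q'(2)] q True by (intro mult_left_mono) auto
        ultimately have "(\<psi> has_real_derivative - 3 * (1 - u x q)\<^sup>2 * dt u x q + 3 * \<epsilon>) (at q)"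
          "\<epsilon> \<le> (1 - u x q)\<^sup>2 * dt u x q" by linarith+
        then show "\<exists>y. (\<psi> has_real_derivative y) (at q) \<and> y \<le> 0"
          by (intro exI[of _ "- 3 * (1 - u x q)\<^sup>2 * dt u x q + 3 * \<epsilon>"]) auto
      qed
      moreover have "0 \<le> (1 - u x s) ^ 3" using u_less_1[OF closureI[OF x], of s] t s by simp
      ultimately show ?thesis unfolding \<psi>_def right_diff_distrib by linarith
    qed
    have lim: "((\<lambda>s. 3 * \<epsilon> * (s - t)) \<longlongrightarrow> 3 * \<epsilon> * (T - t)) (at_left T)"
      by (intro tendsto_intros)
    have "\<forall>\<^sub>F s in at_left T. 3 * \<epsilon> * (s - t) \<le> (1 - u x t) ^ 3"
      using eventually_at_left_real[OF t(2)] by eventually_elim (use step in auto)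
    from tendsto_upperbound[OF lim this] have "3 * \<epsilon> * (T - t) \<le> (1 - u x t) ^ 3" by simp
    moreover have "A * (T - t) \<le> 3 * \<epsilon> * (T - t)" using A t by (intro mult_right_mono) auto
    ultimately show ?thesis by simp
  qed
  show ?thesis
  proof (intro exI[of _ "A powr (1 / 3)"] conjI ballI)
    show "0 < A powr (1 / 3)" using A by simp
    fix x t assume x: "x \<in> \<Omega>" and "t \<in> {0..<T}"
    then have t: "0 \<le> t" "t < T" by auto
    have pos: "0 < 1 - u x t" using u_less_1[OF closureI[OF x] t] by simp
    have "A powr (1 / 3) * (T - t) powr (1 / 3) = (A * (T - t)) powr (1 / 3)"
      using A t by (simp add: powr_mult)
    also have "\<dots> \<le> ((1 - u x t) ^ 3) powr (1 / 3)"
      using cube[OF x t] A t by (intro powr_mono2) auto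
    also have "(1 - u x t) ^ 3 = (1 - u x t) powr 3"
      using pos powr_realpow[of "1 - u x t" 3] by simp
    also have "\<dots> powr (1 / 3) = 1 - u x t" unfolding powr_powr using pos by simp
    finally show "A powr (1 / 3) * (T - t) powr (1 / 3) \<le> 1 - u x t" .
  qed
qed

lemma dt_blows_up: "dt_blows_up_at_quenching \<Omega> T u"
  unfolding dt_blows_up_at_quenching_def
proof (intro allI impI, elim conjE)
  fix x :: "nat \<Rightarrow> real ^ 'n" and t :: "nat \<Rightarrow> real"
  assume xt: "\<forall>j. x j \<in> \<Omega> \<and> t j \<in> {0..<T}" and lim: "(\<lambda>j. u (x j) (t j)) \<longlonglongrightarrow> 1"
  obtain \<epsilon> r0 where \<epsilon>: "0 < \<epsilon>" and r0: "r0 < 1"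
    and low: "\<And>x t. x \<in> \<Omega> \<Longrightarrow> 0 \<le> t \<Longrightarrow> t < T \<Longrightarrow> r0 \<le> u x t \<Longrightarrow> \<epsilon> * (recip_gap (u x t))\<^sup>2 \<le> dt u x t"
    using dt_lower_bound by blast
  have less: "u (x j) (t j) < 1" for j using xt u_less_1 closureI by simp
  have "((\<lambda>j. 1 - u (x j) (t j)) \<longlongrightarrow> 1 - 1) sequentially" by (intro tendsto_intros lim)
  then have "filterlim (\<lambda>j. 1 - u (x j) (t j)) (at_right 0) sequentially"
    using less by (auto simp: filterlim_at less_imp_neq)
  then have "filterlim (\<lambda>j. recip_gap (u (x j) (t j))) at_top sequentially"
    unfolding recip_gap_def divide_inverse using filterlim_compose[OF filterlim_inverse_at_top_right] by simp
  then have "filterlim (\<lambda>j. \<epsilon> * (recip_gap (u (x j) (t j)))\<^sup>2) at_top sequentially"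
    using \<epsilon> by (intro filterlim_tendsto_pos_mult_at_top[OF tendsto_const] filterlim_pow_at_top) auto
  moreover have "\<forall>\<^sub>F j in sequentially. r0 < u (x j) (t j)"
    using order_tendstoD(1)[OF lim r0] .
  then have "\<forall>\<^sub>F j in sequentially. \<epsilon> * (recip_gap (u (x j) (t j)))\<^sup>2 \<le> dt u (x j) (t j)"
    by eventually_elim (use xt low in auto)
  ultimately show "filterlim (\<lambda>j. dt u (x j) (t j)) at_top sequentially"
    by (rule filterlim_at_top_mono)
qed

end

theorem lemma1p4:
  fixes \<mu> \<delta> T :: real and S :: ereal
    and \<Omega> :: "(real ^ 'n) set" and u :: "real ^ 'n \<Rightarrow> real \<Rightarrow> real"
  assumes "\<mu> > 0" and "\<delta> > 0"
    and "open \<Omega>" and "connected \<Omega>" and "\<Omega> \<noteq> {}" and "convex \<Omega>" and "bounded \<Omega>"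
    and "maximal_solution \<mu> \<delta> \<Omega> S u"
    and "quenching_time \<Omega> S u = ereal T"
  shows "(\<exists>M::real. 0 < M \<and> (\<forall>x\<in>\<Omega>. \<forall>t\<in>{0..<T}. M * (T - t) powr (1/3) \<le> 1 - u x t)) \<and>
         dt_blows_up_at_quenching \<Omega> T u"
proof -
  \<comment> \<open>Only times before \<open>S\<close> compete in the quenching time.\<close>
  have "quenching_time \<Omega> S u \<le> S"
    unfolding quenching_time_def by (rule Sup_least) (auto simp: time_interval_def)
  then have TS: "ereal T \<le> S" using assms(9) by simp
  obtain H where H: "H 0 = 0"
    "\<And>r. r \<in> {-1<..<1} \<Longrightarrow> (H has_real_derivative exp (\<mu> * \<delta> * recip_gap r)) (at r)"
    using linearizing_function_exists[of "\<mu> * \<delta>"] by blast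
  have sol: "solution \<mu> \<delta> \<Omega> S u" using assms(8) by (simp add: maximal_solution_def)
  interpret quenching_flow \<mu> \<delta> T S \<Omega> u H
    by (rule quenching_flow.intro) (fact assms sol TS H)+
  show ?thesis using gap_lower_bound dt_blows_up by blast
qed

end
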